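(* Let $(T^2,g_{st})$ be the 2-torus with its standard flat metric. Let $\phi:(T^2,g_{st})\to(T^2,g_{st})$ be an isometry which does not fix the image of any closed geodesic (an irrational rotation in both coordinates), and let $\widetilde\phi$ be the corresponding strict contactomorphism of the unit cotangent bundle of $T^2$. Let $M_{\widetilde\phi,1}$ be the mapping torus of $\widetilde\phi$, with its exact lcs structure. Then $M_{\widetilde\phi,1}$ has no Reeb 2-curves.
   Context: An exact lcs structure on a manifold $M$ is a pair of 1-forms $(\lambda,\alpha)$ with $\alpha$ closed and $\omega=d_\alpha\lambda:=d\lambda-\alpha\wedge\lambda$ non-degenerate. Define vector fields by $\omega(X_\lambda,\cdot)=\lambda$, $\omega(X_\alpha,\cdot)=\alpha$; the canonical (generalized) distribution is $\mathcal{D}(p)=\operatorname{span}(X_\alpha(p),X_\lambda(p))$. The unit cotangent bundle $C$ of $(T^2,g_{st})$ carries the Liouville contact form $\lambda$, and an isometry $\phi$ induces a strict contactomorphism $\widetilde\phi$ of $(C,\lambda)$ (i.e. $\widetilde\phi^*\lambda=\lambda$). Mapping torus: $M_{\widetilde\phi,1}=C\times\mathbb{R}/\big((x,\theta)\sim(\widetilde\phi(x),\theta+1)\big)$, with $\alpha$ the pullback of $d\theta$ from $\mathbb{R}/\mathbb{Z}$ and the 1-form $\lambda_{\widetilde\phi}$ induced by the pullback of $\lambda$; $(\lambda_{\widetilde\phi},\alpha)$ is an exact lcs structure. A nodal Riemann surface is $\Sigma=(\widetilde\Sigma,\mathcal{N})$ with $\widetilde\Sigma$ a Riemann surface and $\mathcal{N}$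 a finite set of pairs of points (possibly empty), the points of distinct pairs being distinct; $\Sigma$ also denotes the quotient of $\widetilde\Sigma$ identifying the points of each pair. For a map $u:\Sigma\to M$, the normalization $\widetilde u:\widetilde\Sigma\to M$ is its composition with the quotient map; $u$ is smooth if $\widetilde u$ is. A Reeb 2-curve in $(M,\lambda,\alpha)$ is a smooth map $u:\Sigma\to M$ from a closed nodal Riemann surface such that: (1) for each $z\in\widetilde\Sigma$, $\widetilde u_*(T_z\widetilde\Sigma)=\mathcal{D}(\widetilde u(z))$ whenever $d\widetilde u(z)\neq 0$ and $\dim\mathcal{D}(\widetilde u(z))=2$; (2) $0\neq[u^*\alpha]\in H^1(\Sigma,\mathbb{R})$.
   Formalization: The hypothesis that φ does not fix the image of any closed geodesic is required of all iterates φ^k, k ≥ 1; for φ alone the claim fails, e.g. rotation by (√2, √2+1/2), where φ² fixes geodesics of direction (1,1) and a Reeb 2-curve exists. *)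

theory Defs
  imports "HOL-Analysis.Analysis"
begin

section \<open>Manifolds\<close>

text \<open>
  A manifold is given by an indexed atlas \<open>(U\<^sub>i, \<kappa>\<^sub>i)\<close> with \<open>\<kappa>\<^sub>i : U\<^sub>i \<rightarrow> 'e\<close>. The set of points is the
  union of the chart domains, and the topology is the one determined by the charts. Vectors and
  forms are given by their components in the charts: \<open>\<beta> i p v\<close> is the value of the 1-form \<open>\<beta>\<close> on the
  tangent vector at \<open>p\<close> whose coordinates in the \<open>i\<close>-th chart are \<open>v\<close>.
\<close>

record ('a, 'i, 'e) manifold =
  idx :: "'i set"
  cdom :: "'i \<Rightarrow> 'a set"
  cmap :: "'i \<Rightarrow> 'a \<Rightarrow> 'e"

definition points :: "('a, 'i, 'e) manifold \<Rightarrow> 'a set" where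
  "points M = (\<Union>i\<in>idx M. cdom M i)"

definition cinv :: "('a, 'i, 'e) manifold \<Rightarrow> 'i \<Rightarrow> 'e \<Rightarrow> 'a" where
  "cinv M i = inv_into (cdom M i) (cmap M i)"

definition manifold_topology :: "('a, 'i, 'e::topological_space) manifold \<Rightarrow> 'a topology" where
  "manifold_topology M = topology (\<lambda>U. U \<subseteq> points M \<and>
     (\<forall>i\<in>idx M. open (cmap M i ` (U \<inter> cdom M i))))"

primrec C_on :: "nat \<Rightarrow> 'a::real_normed_vector set \<Rightarrow> ('a \<Rightarrow> 'b::real_normed_vector) \<Rightarrow> bool" where
  "C_on 0 S f \<longleftrightarrow> continuous_on S f"
| "C_on (Suc k) S f \<longleftrightarrow> (\<forall>x\<in>S. f differentiable (at x)) \<and>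
     (\<forall>v. C_on k S (\<lambda>x. frechet_derivative f (at x) v))"

definition smooth_on :: "'a::real_normed_vector set \<Rightarrow> ('a \<Rightarrow> 'b::real_normed_vector) \<Rightarrow> bool" where
  "smooth_on S f \<longleftrightarrow> (\<forall>k. C_on k S f)"

text \<open>Openness of the sets below, over all charts of the target, is continuity of \<open>f\<close>.\<close>

definition smooth_map ::
  "('a, 'i, 'e::real_normed_vector) manifold \<Rightarrow> ('b, 'j, 'f::real_normed_vector) manifold \<Rightarrow>
   ('a \<Rightarrow> 'b) \<Rightarrow> bool" where
  "smooth_map M N f \<longleftrightarrow> f ` points M \<subseteq> points N \<and>
     (\<forall>i\<in>idx M. \<forall>j\<in>idx N.
        open (cmap M i ` (cdom M i \<inter> f -` cdom N j)) \<and>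
        smooth_on (cmap M i ` (cdom M i \<inter> f -` cdom N j)) (cmap N j \<circ> f \<circ> cinv M i))"

text \<open>The differential of \<open>f\<close> at \<open>p\<close>, expressed in the chart \<open>i\<close> at \<open>p\<close> and the chart \<open>j\<close> at \<open>f p\<close>.\<close>

definition dmap ::
  "('a, 'i, 'e::real_normed_vector) manifold \<Rightarrow> ('b, 'j, 'f::real_normed_vector) manifold \<Rightarrow>
   ('a \<Rightarrow> 'b) \<Rightarrow> 'i \<Rightarrow> 'j \<Rightarrow> 'a \<Rightarrow> 'e \<Rightarrow> 'f" where
  "dmap M N f i j p = frechet_derivative (cmap N j \<circ> f \<circ> cinv M i) (at (cmap M i p))"

definition euclid :: "('e, unit, 'e) manifold" where
  "euclid = \<lparr>idx = UNIV, cdom = (\<lambda>_. UNIV), cmap = (\<lambda>_ x. x)\<rparr>"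

type_synonym ('a, 'i, 'e) one_form = "'i \<Rightarrow> 'a \<Rightarrow> 'e \<Rightarrow> real"

definition pullback ::
  "('a, 'i, 'e::real_normed_vector) manifold \<Rightarrow> ('b, 'j, 'f::real_normed_vector) manifold \<Rightarrow>
   ('a \<Rightarrow> 'b) \<Rightarrow> ('b, 'j, 'f) one_form \<Rightarrow> ('a, 'i, 'e) one_form" where
  "pullback M N f \<beta> i p v =
     (let j = (SOME j. j \<in> idx N \<and> f p \<in> cdom N j) in \<beta> j (f p) (dmap M N f i j p v))"

definition ext_deriv ::
  "('a, 'i, 'e::real_normed_vector) manifold \<Rightarrow> ('a, 'i, 'e) one_form \<Rightarrow>
   'i \<Rightarrow> 'a \<Rightarrow> 'e \<Rightarrow> 'e \<Rightarrow> real" where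
  "ext_deriv M \<beta> i p v w =
     frechet_derivative (\<lambda>x. \<beta> i (cinv M i x) w) (at (cmap M i p)) v
     - frechet_derivative (\<lambda>x. \<beta> i (cinv M i x) v) (at (cmap M i p)) w"

section \<open>Riemannian metrics\<close>

type_synonym ('a, 'i, 'e) metric = "'i \<Rightarrow> 'a \<Rightarrow> 'e \<Rightarrow> 'e \<Rightarrow> real"

definition riemannian_isometry ::
  "('a, 'i, 'e::real_normed_vector) manifold \<Rightarrow> ('a, 'i, 'e) metric \<Rightarrow>
   ('b, 'j, 'f::real_normed_vector) manifold \<Rightarrow> ('b, 'j, 'f) metric \<Rightarrow> ('a \<Rightarrow> 'b) \<Rightarrow> bool" where
  "riemannian_isometry M g N h f \<longleftrightarrow>
     bij_betw f (points M) (points N) \<and> smooth_map M N f \<and> smooth_map N M (inv_into (points M) f) \<and>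
     (\<forall>i\<in>idx M. \<forall>j\<in>idx N. \<forall>p\<in>cdom M i \<inter> f -` cdom N j. \<forall>v w.
        h j (f p) (dmap M N f i j p v) (dmap M N f i j p w) = g i p v w)"

definition velocity ::
  "('a, 'i, 'e::real_normed_vector) manifold \<Rightarrow> (real \<Rightarrow> 'a) \<Rightarrow> 'i \<Rightarrow> real \<Rightarrow> 'e" where
  "velocity M \<gamma> i t = dmap euclid M \<gamma> () i t 1"

text \<open>
  The geodesic equation, in coordinates and in Euler-Lagrange form:
  \<open>d/dt g(\<gamma>', w) = 1/2 \<partial>\<^sub>w g(\<gamma>', \<gamma>')\<close> for every coordinate vector \<open>w\<close>.
\<close>

definition geodesic ::
  "('a, 'i, 'e::real_normed_vector) manifold \<Rightarrow> ('a, 'i, 'e) metric \<Rightarrow> (real \<Rightarrow> 'a) \<Rightarrow> bool" where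
  "geodesic M g \<gamma> \<longleftrightarrow> smooth_map euclid M \<gamma> \<and>
     (\<forall>i\<in>idx M. \<forall>t\<in>\<gamma> -` cdom M i. \<forall>w.
        ((\<lambda>s. g i (\<gamma> s) (velocity M \<gamma> i s) w) has_real_derivative
           frechet_derivative (\<lambda>x. g i (cinv M i x) (velocity M \<gamma> i t) (velocity M \<gamma> i t))
             (at (cmap M i (\<gamma> t))) w / 2) (at t))"

definition closed_geodesic ::
  "('a, 'i, 'e::real_normed_vector) manifold \<Rightarrow> ('a, 'i, 'e) metric \<Rightarrow> (real \<Rightarrow> 'a) \<Rightarrow> bool" where
  "closed_geodesic M g \<gamma> \<longleftrightarrow> geodesic M g \<gamma> \<and> (\<exists>s t. \<gamma> s \<noteq> \<gamma> t) \<and> (\<exists>T>0. \<forall>t. \<gamma> (t + T) = \<gamma> t)"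

section \<open>Exact lcs structures\<close>

text \<open>\<open>\<omega> = d\<lambda> - \<alpha> \<and> \<lambda>\<close>, where \<open>lam\<close> stands for \<open>\<lambda>\<close>.\<close>

definition lcs_form ::
  "('a, 'i, 'e::real_normed_vector) manifold \<Rightarrow> ('a, 'i, 'e) one_form \<Rightarrow> ('a, 'i, 'e) one_form \<Rightarrow>
   'i \<Rightarrow> 'a \<Rightarrow> 'e \<Rightarrow> 'e \<Rightarrow> real" where
  "lcs_form M lam \<alpha> i p v w =
     ext_deriv M lam i p v w - (\<alpha> i p v * lam i p w - \<alpha> i p w * lam i p v)"

text \<open>The vector dual to the 1-form \<open>\<beta>\<close>: \<open>\<omega>(X\<^sub>\<beta>, \<cdot>) = \<beta>\<close>.\<close>

definition lcs_dual ::
  "('a, 'i, 'e::real_normed_vector) manifold \<Rightarrow> ('a, 'i, 'e) one_form \<Rightarrow> ('a, 'i, 'e) one_form \<Rightarrow>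
   ('a, 'i, 'e) one_form \<Rightarrow> 'i \<Rightarrow> 'a \<Rightarrow> 'e" where
  "lcs_dual M lam \<alpha> \<beta> i p = (THE X. \<forall>w. lcs_form M lam \<alpha> i p X w = \<beta> i p w)"

definition canonical_distribution ::
  "('a, 'i, 'e::real_normed_vector) manifold \<Rightarrow> ('a, 'i, 'e) one_form \<Rightarrow> ('a, 'i, 'e) one_form \<Rightarrow>
   'i \<Rightarrow> 'a \<Rightarrow> 'e set" where
  "canonical_distribution M lam \<alpha> i p = span {lcs_dual M lam \<alpha> \<alpha> i p, lcs_dual M lam \<alpha> lam i p}"

section \<open>Nodal Riemann surfaces and Reeb 2-curves\<close>

text \<open>Riemann surfaces are not assumed to be connected.\<close>

definition riemann_surface :: "('s, 'i, complex) manifold \<Rightarrow> bool" where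
  "riemann_surface S \<longleftrightarrow>
     (\<forall>i\<in>idx S. inj_on (cmap S i) (cdom S i)) \<and>
     (\<forall>i\<in>idx S. \<forall>j\<in>idx S. open (cmap S i ` (cdom S i \<inter> cdom S j)) \<and>
        (cmap S j \<circ> cinv S i) holomorphic_on (cmap S i ` (cdom S i \<inter> cdom S j))) \<and>
     Hausdorff_space (manifold_topology S) \<and> second_countable (manifold_topology S)"

definition closed_nodal_riemann_surface :: "('s, 'i, complex) manifold \<Rightarrow> 's set set \<Rightarrow> bool" where
  "closed_nodal_riemann_surface S N \<longleftrightarrow>
     riemann_surface S \<and> compact_space (manifold_topology S) \<and>
     finite N \<and> (\<forall>e\<in>N. e \<subseteq> points S \<and> card e = 2) \<and> disjoint N"

text \<open>The quotient map onto the nodal surface; its points are equivalence classes.\<close>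

definition nodal_proj :: "'s set set \<Rightarrow> 's \<Rightarrow> 's set" where
  "nodal_proj N z = insert z (\<Union>{e \<in> N. z \<in> e})"

text \<open>
  Vanishing of the class of a closed 1-form \<open>\<beta>\<close> in the first de Rham cohomology of the nodal surface:
  \<open>\<beta>\<close> is the differential of a function on the quotient (whose values at the two points of
  a node thus agree), smooth in the sense that its normalization is.
\<close>

definition nodal_exact ::
  "('s, 'i, complex) manifold \<Rightarrow> 's set set \<Rightarrow> ('s, 'i, complex) one_form \<Rightarrow> bool" where
  "nodal_exact S N \<beta> \<longleftrightarrow>
     (\<exists>F :: 's set \<Rightarrow> real. smooth_map S euclid (F \<circ> nodal_proj N) \<and>
        (\<forall>i\<in>idx S. \<forall>z\<in>cdom S i. \<forall>v. dmap S euclid (F \<circ> nodal_proj N) i () z v = \<beta> i z v))"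

definition reeb_2_curve ::
  "('a, 'j, 'e::euclidean_space) manifold \<Rightarrow> ('a, 'j, 'e) one_form \<Rightarrow> ('a, 'j, 'e) one_form \<Rightarrow>
   ('s, 'i, complex) manifold \<Rightarrow> 's set set \<Rightarrow> ('s set \<Rightarrow> 'a) \<Rightarrow> bool" where
  "reeb_2_curve M lam \<alpha> S N u \<longleftrightarrow>
     closed_nodal_riemann_surface S N \<and>
     smooth_map S M (u \<circ> nodal_proj N) \<and>
     (\<forall>i\<in>idx S. \<forall>j\<in>idx M. \<forall>z\<in>cdom S i \<inter> (u \<circ> nodal_proj N) -` cdom M j.
        dmap S M (u \<circ> nodal_proj N) i j z \<noteq> (\<lambda>_. 0) \<and>
        dim (canonical_distribution M lam \<alpha> j ((u \<circ> nodal_proj N) z)) = 2 \<longrightarrow>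
        range (dmap S M (u \<circ> nodal_proj N) i j z)
          = canonical_distribution M lam \<alpha> j ((u \<circ> nodal_proj N) z)) \<and>
     \<not> nodal_exact S N (pullback S M (u \<circ> nodal_proj N) \<alpha>)"

section \<open>The flat torus and its unit cotangent bundle\<close>

text \<open>\<open>T\<^sup>2 = \<real>\<^sup>2 / \<int>\<^sup>2\<close>, with the charts inverting the projection on open unit squares.\<close>

type_synonym torus_point = "(real \<times> real) set"

definition torus_proj :: "real \<times> real \<Rightarrow> torus_point" where
  "torus_proj x = {x + z |z. z \<in> \<int> \<times> \<int>}"

definition torus :: "(torus_point, real \<times> real, real \<times> real) manifold" where
  "torus = \<lparr>idx = UNIV,
     cdom = (\<lambda>a. torus_proj ` box a (a + (1, 1))),
     cmap = (\<lambda>a q. THE x. x \<in> q \<and> x \<in> box a (a + (1, 1)))\<rparr>"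

definition flat_metric :: "(torus_point, real \<times> real, real \<times> real) metric" where
  "flat_metric a q v w = v \<bullet> w"

text \<open>
  The transition maps of these charts are translations, so the components of a covector do not
  depend on the chart: a unit covector at \<open>q\<close> is a pair \<open>(q, p)\<close> with \<open>p\<close> in the unit circle, acting
  by \<open>v \<mapsto> p \<bullet> v\<close>. The circle is parametrized by angles in intervals of length \<open>2\<pi>\<close>.
\<close>

definition unit_cotangent ::
  "(torus_point \<times> (real \<times> real), (real \<times> real) \<times> real, (real \<times> real) \<times> real) manifold" where
  "unit_cotangent = \<lparr>idx = UNIV,
     cdom = (\<lambda>(a, b). cdom torus a \<times> (\<lambda>s. (cos s, sin s)) ` {b<..<b + 2 * pi}),
     cmap = (\<lambda>(a, b) (q, p).
       (cmap torus a q, THE s. s \<in> {b<..<b + 2 * pi} \<and> p = (cos s, sin s)))\<rparr>"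

definition liouville ::
  "(torus_point \<times> (real \<times> real), (real \<times> real) \<times> real, (real \<times> real) \<times> real) one_form" where
  "liouville i x v = snd x \<bullet> fst v"

text \<open>
  The map \<open>(q, p) \<mapsto> (\<phi>(q), p \<circ> d\<phi>(q)\<^sup>-\<^sup>1)\<close> of the unit cotangent bundle.
\<close>

definition cotangent_lift ::
  "(torus_point \<Rightarrow> torus_point) \<Rightarrow> torus_point \<times> (real \<times> real) \<Rightarrow> torus_point \<times> (real \<times> real)" where
  "cotangent_lift \<phi> = (\<lambda>(q, p). (\<phi> q, THE p'.
     \<forall>a b v. q \<in> cdom torus a \<and> \<phi> q \<in> cdom torus b \<longrightarrow> p' \<bullet> dmap torus torus \<phi> a b q v = p \<bullet> v))"

text \<open>
  On irrational rotations. The rotation \<open>\<phi> (x, y) = (x + a, y + b)\<close> and all its iterates \<open>\<phi> ^^ k\<close>, \<open>k \<ge> 1\<close>,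
  move the image of every closed geodesic iff \<open>1, a, b\<close> are linearly independent over the
  rationals. That \<open>\<phi>\<close> itself does so and that \<open>a\<close> and \<open>b\<close> are irrational is weaker: for
  \<open>a = sqrt 2\<close>, \<open>b = sqrt 2 + 1/2\<close>, the square of \<open>\<phi>\<close> fixes each geodesic of direction \<open>(1, -1)\<close>, although
  \<open>\<phi>\<close> fixes no closed geodesic. For such \<open>\<phi>\<close> the suspension of the lifted geodesic over
  the time interval of length 2 is a Reeb 2-curve, a torus. The absence of Reeb 2-curves therefore
  requires the condition on all iterates.
\<close>

section \<open>Mapping tori\<close>

text \<open>
  For a bijection \<open>f\<close> of the points of \<open>C\<close>, the mapping torus is the quotient of \<open>C \<times> \<real>\<close> by the
  equivalence relation generated by \<open>(x, \<theta>) \<sim> (f x, \<theta> + 1)\<close>. A class has exactly one representative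
  at each height congruent to \<open>\<theta>\<close> modulo 1, so that the projection is injective
  on \<open>C \<times> {b<..<b + 1}\<close>; the charts invert it there.
\<close>

definition mt_step :: "'a set \<Rightarrow> ('a \<Rightarrow> 'a) \<Rightarrow> 'a \<times> real \<Rightarrow> 'a \<times> real \<Rightarrow> bool" where
  "mt_step X f y z \<longleftrightarrow> fst y \<in> X \<and> z = (f (fst y), snd y + 1)"

definition mt_proj :: "'a set \<Rightarrow> ('a \<Rightarrow> 'a) \<Rightarrow> 'a \<times> real \<Rightarrow> ('a \<times> real) set" where
  "mt_proj X f y = {z. equivclp (mt_step X f) y z}"

definition mt_rep :: "real \<Rightarrow> ('a \<times> real) set \<Rightarrow> 'a \<times> real" where
  "mt_rep b P = (THE y. y \<in> P \<and> snd y \<in> {b<..<b + 1})"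

definition mapping_torus ::
  "('a, 'i, 'e) manifold \<Rightarrow> ('a \<Rightarrow> 'a) \<Rightarrow> (('a \<times> real) set, 'i \<times> real, 'e \<times> real) manifold" where
  "mapping_torus C f = \<lparr>idx = idx C \<times> UNIV,
     cdom = (\<lambda>(i, b). mt_proj (points C) f ` (cdom C i \<times> {b<..<b + 1})),
     cmap = (\<lambda>(i, b) P. (cmap C i (fst (mt_rep b P)), snd (mt_rep b P)))\<rparr>"

text \<open>The 1-form induced by the pullback of an \<open>f\<close>-invariant 1-form to \<open>C \<times> \<real>\<close>, and the form \<open>d\<theta>\<close>.\<close>

definition mt_form ::
  "('a, 'i, 'e) one_form \<Rightarrow> (('a \<times> real) set, 'i \<times> real, 'e \<times> real) one_form" where
  "mt_form lam = (\<lambda>(i, b) P v. lam i (fst (mt_rep b P)) (fst v))"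

definition mt_dtheta :: "(('a \<times> real) set, 'i \<times> real, 'e \<times> real) one_form" where
  "mt_dtheta j P v = snd v"

end

theory Submission
  imports Defs
begin

text \<open>
  The isometry is affine: it lifts to \<open>x \<mapsto> b + A x\<close> with \<open>A\<close> orthogonal (\<open>torus_isometry_affine\<close>), and its cotangent
  lift is \<open>(x, p) \<mapsto> (b + A x, A p)\<close>. In coordinates \<open>(x, s, \<theta>)\<close> of the mapping torus, with
  \<open>p = (cos s, sin s)\<close>, the vector dual to \<open>\<alpha>\<close> is the Reeb field \<open>(p, 0, 0)\<close> and the vector dual to \<open>\<lambda>\<close>
  is \<open>- \<partial>\<^sub>\<theta>\<close> (\<open>canonical_distribution_M\<close>). The canonical distribution is thus integrable: its leaves are the
  suspensions of the geodesics with covector \<open>p\<close>, and each is a quotient of the plane with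
  coordinates along \<open>p\<close> and \<open>\<theta>\<close> by a discrete group of periods.

  The hypothesis on \<open>\<phi>\<close> implies that the periods of a leaf lie on a line (\<open>periods_parallel\<close>). Two
  independent periods would yield a horizontal one, which says that the geodesic is closed, and one of
  positive height \<open>k\<close>, which says that \<open>\<phi>\<close> iterated \<open>k\<close> times translates the geodesic along itself. So
  every leaf is a plane or a cylinder, and in particular not compact.

  A Reeb 2-curve stays locally in a leaf, and its derivative has rank 0 or 2 there
  (\<open>local_leaf_coordinates\<close>). A compact surface without boundary admits no such map into a plane or a
  cylinder unless the derivative vanishes (\<open>reeb_curve_constant\<close>): the image is compact and is open
  at its regular values, and almost every line in a given direction avoids the critical values, so such a
  line is covered entirely as soon as it is met. That the critical values are a null set in the leaf would
  not suffice, since a null set may separate the plane; instead, Sard's theorem is applied to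
  a linear function of the leaf coordinates (\<open>Sard_two_variables\<close>), whose critical values are a null set of the line.

  Hence the derivative of a Reeb 2-curve is zero. Then \<open>\<alpha>\<close> pulls back to zero, which is exact,
  contrary to the definition.
\<close>

text \<open>Points of the plane and coordinates of charts are nested pairs; quantifiers over them are kept whole.\<close>

declare split_paired_All [simp del] split_paired_Ex [simp del]

section \<open>Sard's theorem for functions of two variables\<close>

lemma negligible_image_if_locally:
  fixes h :: "'a::second_countable_topology \<Rightarrow> 'b::euclidean_space"
  assumes "\<And>x. x \<in> E \<Longrightarrow> \<exists>V. open V \<and> x \<in> V \<and> negligible (h ` (E \<inter> V))"
  shows "negligible (h ` E)"
proof -
  define F where "F = {V. open V \<and> negligible (h ` (E \<inter> V))}"
  obtain F' where F': "F' \<subseteq> F" "countable F'" "\<Union>F' = \<Union>F"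
    using Lindelof[of F] by (auto simp: F_def)
  have "E \<subseteq> \<Union>F" using assms by (auto simp: F_def)
  then have "h ` E \<subseteq> (\<Union>V\<in>F'. h ` (E \<inter> V))" using F'(3) by blast
  moreover have "negligible (\<Union>V\<in>F'. h ` (E \<inter> V))"
    using F' by (intro negligible_countable_Union) (auto simp: F_def)
  ultimately show ?thesis by (rule negligible_subset[rotated])
qed

lemma negligible_image_if_derivative_zero:
  fixes g :: "real \<Rightarrow> real"
  assumes "\<And>t. t \<in> T \<Longrightarrow> (g has_derivative (\<lambda>_. 0)) (at t within T)"
  shows "negligible (g ` T)"
proof -
  define f :: "real^1 \<Rightarrow> real^1" where "f = (\<lambda>v. vec (g (v $ 1)))"
  define S :: "(real^1) set" where "S = vec ` T"
  have "(f has_derivative (\<lambda>_. 0)) (at v within S)" if "v \<in> S" for v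
    unfolding has_derivative_within_alt
  proof (intro conjI allI impI)
    fix e :: real assume "e > 0"
    obtain t where t: "t \<in> T" "v = vec t" using \<open>v \<in> S\<close> unfolding S_def by blast
    then obtain d where d: "d > 0" "\<And>s. s \<in> T \<Longrightarrow> norm (s - t) < d \<Longrightarrow> norm (g s - g t - 0) \<le> e * norm (s - t)"
      using assms[OF t(1)] \<open>e > 0\<close> unfolding has_derivative_within_alt by meson
    show "\<exists>d>0. \<forall>y\<in>S. norm (y - v) < d \<longrightarrow> norm (f y - f v - 0) \<le> e * norm (y - v)"
      using d t by (auto simp: S_def f_def norm_real intro!: exI[of _ d])
  qed simp
  moreover have "rank (matrix (\<lambda>_::real^1. 0 :: real^1)) < CARD(1)"
    by (simp add: matrix_def flip: zero_vec_def)
  ultimately have "negligible (f ` S)"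
    by (intro baby_Sard[of S f "\<lambda>_ _. 0"]) auto
  then have "negligible ((\<lambda>v::real^1. v $ 1) ` (f ` S))"
    by (rule negligible_differentiable_image_negligible[rotated])
      (auto intro!: derivative_intros linear_imp_differentiable_on bounded_linear_imp_differentiable_on bounded_linear_vec_nth)
  then show ?thesis by (simp add: image_image f_def S_def)
qed

text \<open>The cells of a grid of mesh \<open>R / n\<close> that meet a disc of radius \<open>R\<close> number \<open>O(n\<^sup>2)\<close>, and the image of
  each has length \<open>O(\<epsilon> (R / n)\<^sup>2)\<close>, so the image of the disc has measure \<open>O(\<epsilon> R\<^sup>2)\<close>.\<close>

lemma negligible_image_if_quadratic:
  fixes h :: "complex \<Rightarrow> real"
  assumes E: "bounded E"
    and quad: "\<And>\<epsilon>. \<epsilon> > 0 \<Longrightarrow> \<exists>\<delta>>0. \<forall>z\<in>E. \<forall>w\<in>E. norm (w - z) < \<delta> \<longrightarrow> \<bar>h w - h z\<bar> \<le> \<epsilon> * (norm (w - z))\<^sup>2"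
  shows "negligible (h ` E)"
  unfolding negligible_outer_le
proof (intro allI impI)
  fix e :: real assume e: "e > 0"
  obtain R where R: "R > 0" "\<And>z. z \<in> E \<Longrightarrow> norm z \<le> R"
    using E bounded_pos by metis
  define \<epsilon> where "\<epsilon> = e / (72 * R\<^sup>2)"
  have \<epsilon>: "\<epsilon> > 0" using e R by (simp add: \<epsilon>_def)
  obtain \<delta> where \<delta>: "\<delta> > 0" "\<And>z w. z \<in> E \<Longrightarrow> w \<in> E \<Longrightarrow> norm (w - z) < \<delta> \<Longrightarrow> \<bar>h w - h z\<bar> \<le> \<epsilon> * (norm (w - z))\<^sup>2"
    using quad[OF \<epsilon>] by blast
  obtain n :: nat where n: "real n > 2 * R / \<delta>" "n > 0"
    by (metis gr0I less_trans of_nat_0_less_iff R(1) \<delta>(1) divide_pos_pos mult_pos_pos reals_Archimedean2 zero_less_numeral)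
  \<comment> \<open>The cell with index \<open>k\<close> in one coordinate is \<open>[k \<rho>, (k + 1) \<rho>)\<close>; the index \<open>n\<close> occurs only for the end point \<open>R\<close>.\<close>
  define \<rho> where "\<rho> = R / real n"
  have \<rho>: "\<rho> > 0" "2 * \<rho> < \<delta>" "real n * \<rho> = R"
    using R n \<delta>(1) by (simp_all add: \<rho>_def field_simps)
  define cell where "cell = (\<lambda>z. (\<lfloor>Re z / \<rho>\<rfloor>, \<lfloor>Im z / \<rho>\<rfloor>))"
  define I where "I = {- int n .. int n} \<times> {- int n .. int n}"
  have cellI: "cell z \<in> I" if "z \<in> E" for z
  proof -
    have "\<bar>Re z\<bar> \<le> real n * \<rho>" "\<bar>Im z\<bar> \<le> real n * \<rho>"
      using R(2)[OF that] abs_Re_le_cmod[of z] abs_Im_le_cmod[of z] \<rho>(3) by auto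
    then have "- real n \<le> Re z / \<rho>" "Re z / \<rho> \<le> real n" "- real n \<le> Im z / \<rho>" "Im z / \<rho> \<le> real n"
      using \<rho>(1) by (simp_all add: pos_divide_le_eq pos_le_divide_eq abs_le_iff)
    then show ?thesis
      by (auto simp: cell_def I_def le_floor_iff floor_le_iff)
  qed
  have near: "norm (w - z) \<le> 2 * \<rho>" if "cell z = cell w" for z w
  proof -
    have fl: "\<bar>x - y\<bar> \<le> \<rho>" if "\<lfloor>x / \<rho>\<rfloor> = \<lfloor>y / \<rho>\<rfloor>" for x y
    proof -
      have "x / \<rho> - y / \<rho> \<le> 1" "y / \<rho> - x / \<rho> \<le> 1" using that by linarith+
      then have "(x - y) / \<rho> \<le> 1" "(y - x) / \<rho> \<le> 1" by (simp_all add: diff_divide_distrib)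
      then show ?thesis using \<rho>(1) by (simp add: pos_divide_le_eq)
    qed
    have "norm (w - z) \<le> \<bar>Re (w - z)\<bar> + \<bar>Im (w - z)\<bar>" by (rule cmod_le)
    also have "\<dots> \<le> \<rho> + \<rho>"
      using that by (intro add_mono) (auto simp: cell_def intro!: fl)
    finally show ?thesis by simp
  qed
  define pt where "pt = (\<lambda>c. SOME z. z \<in> E \<and> cell z = c)"
  define r where "r = \<epsilon> * (2 * \<rho>)\<^sup>2"
  define T where "T = (\<Union>c\<in>I. {h (pt c) - r .. h (pt c) + r})"
  show "\<exists>T. h ` E \<subseteq> T \<and> T \<in> lmeasurable \<and> measure lebesgue T \<le> e"
  proof (intro exI[of _ T] conjI)
    show "h ` E \<subseteq> T"
    proof
      fix y assume "y \<in> h ` E"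
      then obtain z where z: "z \<in> E" "y = h z" by auto
      have p: "pt (cell z) \<in> E" "cell (pt (cell z)) = cell z"
        using someI[of "\<lambda>z'. z' \<in> E \<and> cell z' = cell z" z] z(1) by (auto simp: pt_def)
      have le: "norm (z - pt (cell z)) \<le> 2 * \<rho>" using near[OF p(2)] .
      then have "\<bar>h z - h (pt (cell z))\<bar> \<le> \<epsilon> * (norm (z - pt (cell z)))\<^sup>2"
        using \<rho>(2) by (intro \<delta>(2)[OF p(1) z(1)]) simp
      also have "\<dots> \<le> r"
        unfolding r_def using le \<epsilon> by (intro mult_left_mono power_mono) auto
      finally have "y \<in> {h (pt (cell z)) - r .. h (pt (cell z)) + r}" using z(2) by auto
      then show "y \<in> T" unfolding T_def using cellI[OF z(1)] by blast
    qed
    have fin: "finite I" by (simp add: I_def)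
    show "T \<in> lmeasurable" unfolding T_def using fin by (intro fmeasurable.finite_UN) auto
    have r: "r \<ge> 0" using \<epsilon> by (simp add: r_def)
    have "measure lebesgue T \<le> (\<Sum>c\<in>I. measure lebesgue {h (pt c) - r .. h (pt c) + r})"
      unfolding T_def by (rule measure_UNION_le[OF fin]) auto
    also have "\<dots> = real (card I) * (2 * r)" using r by simp
    also have "card I = (2 * n + 1)\<^sup>2" by (simp add: I_def card_cartesian_product power2_eq_square nat_add_distrib nat_mult_distrib)
    also have "real ((2 * n + 1)\<^sup>2) * (2 * r) = 8 * \<epsilon> * ((real (2 * n + 1)) * \<rho>)\<^sup>2"
      by (simp add: r_def power_mult_distrib)
    also have "real (2 * n + 1) * \<rho> \<le> 3 * real n * \<rho>"
      using n(2) \<rho>(1) by (intro mult_right_mono) auto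
    then have "8 * \<epsilon> * ((real (2 * n + 1)) * \<rho>)\<^sup>2 \<le> 8 * \<epsilon> * (3 * R)\<^sup>2"
      using \<epsilon> \<rho> by (intro mult_left_mono power_mono) (auto simp: mult.assoc)
    also have "\<dots> = e" using R(1) by (simp add: \<epsilon>_def power_mult_distrib)
    finally show "measure lebesgue T \<le> e" by simp
  qed
qed

text \<open>The critical set of a function with vanishing second derivatives: by the mean value theorem for
  the first derivatives, and then for the function, the increments are quadratically small.\<close>

lemma negligible_image_flat_critical:
  fixes h :: "complex \<Rightarrow> real"
  assumes U: "open U"
    and h: "\<And>z. z \<in> U \<Longrightarrow> (h has_derivative (\<lambda>v. Re v * h1 z + Im v * h2 z)) (at z)"
    and h1: "\<And>z. z \<in> U \<Longrightarrow> (h1 has_derivative (\<lambda>v. Re v * h11 z + Im v * h12 z)) (at z)"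
    and h2: "\<And>z. z \<in> U \<Longrightarrow> (h2 has_derivative (\<lambda>v. Re v * h21 z + Im v * h22 z)) (at z)"
    and cont: "continuous_on U h11" "continuous_on U h12" "continuous_on U h21" "continuous_on U h22"
  shows "negligible (h ` {z \<in> U. h1 z = 0 \<and> h2 z = 0 \<and> h11 z = 0 \<and> h12 z = 0 \<and> h21 z = 0 \<and> h22 z = 0})"
    (is "negligible (h ` ?E)")
proof (rule negligible_image_if_locally)
  have onorm: "onorm (\<lambda>v. Re v * a + Im v * b) \<le> 2 * c" if "\<bar>a\<bar> \<le> c" "\<bar>b\<bar> \<le> c" for a b c :: real
  proof (rule onorm_le)
    fix v :: complex
    have "\<bar>Re v * a + Im v * b\<bar> \<le> \<bar>Re v\<bar> * \<bar>a\<bar> + \<bar>Im v\<bar> * \<bar>b\<bar>"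
      by (metis abs_mult abs_triangle_ineq)
    also have "\<dots> \<le> norm v * c + norm v * c"
      using that by (intro add_mono mult_mono abs_Re_le_cmod abs_Im_le_cmod) auto
    finally show "norm (Re v * a + Im v * b) \<le> 2 * c * norm v" by (simp add: algebra_simps)
  qed
  fix x assume "x \<in> ?E"
  then obtain r where r: "r > 0" "cball x r \<subseteq> U"
    using U open_contains_cball by blast
  define K where "K = cball x r"
  have "negligible (h ` (?E \<inter> K))"
  proof (rule negligible_image_if_quadratic)
    show "bounded (?E \<inter> K)" unfolding K_def using bounded_cball by (rule bounded_subset) auto
    fix \<epsilon> :: real assume \<epsilon>: "\<epsilon> > 0"
    have unif: "\<exists>\<delta>>0. \<forall>z\<in>K. \<forall>w\<in>K. dist w z < \<delta> \<longrightarrow> dist (k w) (k z) < \<epsilon> / 4" if "continuous_on U k" for k :: "complex \<Rightarrow> real"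
    proof -
      have "uniformly_continuous_on K k"
        unfolding K_def
        by (rule compact_uniformly_continuous[OF continuous_on_subset[OF that r(2)] compact_cball])
      moreover have "\<epsilon> / 4 > 0" using \<epsilon> by simp
      ultimately show ?thesis unfolding uniformly_continuous_on_def by blast
    qed
    obtain d1 where d1: "d1 > 0" "\<And>z w. z \<in> K \<Longrightarrow> w \<in> K \<Longrightarrow> dist w z < d1 \<Longrightarrow> dist (h11 w) (h11 z) < \<epsilon> / 4"
      using unif[OF cont(1)] by blast
    obtain d2 where d2: "d2 > 0" "\<And>z w. z \<in> K \<Longrightarrow> w \<in> K \<Longrightarrow> dist w z < d2 \<Longrightarrow> dist (h12 w) (h12 z) < \<epsilon> / 4"
      using unif[OF cont(2)] by blast
    obtain d3 where d3: "d3 > 0" "\<And>z w. z \<in> K \<Longrightarrow> w \<in> K \<Longrightarrow> dist w z < d3 \<Longrightarrow> dist (h21 w) (h21 z) < \<epsilon> / 4"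
      using unif[OF cont(3)] by blast
    obtain d4 where d4: "d4 > 0" "\<And>z w. z \<in> K \<Longrightarrow> w \<in> K \<Longrightarrow> dist w z < d4 \<Longrightarrow> dist (h22 w) (h22 z) < \<epsilon> / 4"
      using unif[OF cont(4)] by blast
    define \<delta> where "\<delta> = Min {d1, d2, d3, d4}"
    show "\<exists>\<delta>>0. \<forall>z\<in>?E \<inter> K. \<forall>w\<in>?E \<inter> K. norm (w - z) < \<delta> \<longrightarrow> \<bar>h w - h z\<bar> \<le> \<epsilon> * (norm (w - z))\<^sup>2"
    proof (intro exI[of _ \<delta>] conjI ballI impI)
      show "\<delta> > 0" using d1 d2 d3 d4 by (simp add: \<delta>_def)
      fix z w assume z: "z \<in> ?E \<inter> K" and w: "w \<in> ?E \<inter> K" and wz: "norm (w - z) < \<delta>"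
      have zK: "z \<in> K" "w \<in> K" and z0: "h1 z = 0" "h2 z = 0" "h11 z = 0" "h12 z = 0" "h21 z = 0" "h22 z = 0"
        using z w by blast+
      define C where "C = K \<inter> cball z (norm (w - z))"
      have "convex C" unfolding C_def K_def by (intro convex_Int convex_cball)
      moreover have "z \<in> C" "w \<in> C" using zK by (simp_all add: C_def dist_norm norm_minus_commute)
      moreover have "C \<subseteq> U" using r(2) by (auto simp: C_def K_def)
      ultimately have C: "convex C" "z \<in> C" "w \<in> C" "C \<subseteq> U" by blast+
      have small: "\<bar>h11 y\<bar> \<le> \<epsilon> / 4" "\<bar>h12 y\<bar> \<le> \<epsilon> / 4" "\<bar>h21 y\<bar> \<le> \<epsilon> / 4" "\<bar>h22 y\<bar> \<le> \<epsilon> / 4" if "y \<in> C" for y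
      proof -
        have "y \<in> K" "dist y z < \<delta>"
          using that wz by (simp_all add: C_def dist_commute)
        then have "y \<in> K" "dist y z < d1" "dist y z < d2" "dist y z < d3" "dist y z < d4"
          by (simp_all add: \<delta>_def)
        then show "\<bar>h11 y\<bar> \<le> \<epsilon> / 4" "\<bar>h12 y\<bar> \<le> \<epsilon> / 4" "\<bar>h21 y\<bar> \<le> \<epsilon> / 4" "\<bar>h22 y\<bar> \<le> \<epsilon> / 4"
          using d1(2)[of z y] d2(2)[of z y] d3(2)[of z y] d4(2)[of z y] zK(1) z0
          by (simp_all add: dist_real_def)
      qed
      have first: "\<bar>h1 y\<bar> \<le> \<epsilon> / 2 * norm (w - z)" "\<bar>h2 y\<bar> \<le> \<epsilon> / 2 * norm (w - z)" if y: "y \<in> C" for y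
      proof -
        have yz: "norm (y - z) \<le> norm (w - z)" using y by (simp add: C_def dist_norm norm_minus_commute)
        have "norm (h1 y - h1 z) \<le> (2 * (\<epsilon> / 4)) * norm (y - z)"
          by (rule differentiable_bound[OF C(1) has_derivative_at_withinI[OF h1[OF subsetD[OF C(4)]]] onorm y C(2)])
            (simp_all only: small)
        also have "\<dots> \<le> (2 * (\<epsilon> / 4)) * norm (w - z)" using yz \<epsilon> by (intro mult_left_mono) auto
        finally show "\<bar>h1 y\<bar> \<le> \<epsilon> / 2 * norm (w - z)" using z0 by simp
        have "norm (h2 y - h2 z) \<le> (2 * (\<epsilon> / 4)) * norm (y - z)"
          by (rule differentiable_bound[OF C(1) has_derivative_at_withinI[OF h2[OF subsetD[OF C(4)]]] onorm y C(2)])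
            (simp_all only: small)
        also have "\<dots> \<le> (2 * (\<epsilon> / 4)) * norm (w - z)" using yz \<epsilon> by (intro mult_left_mono) auto
        finally show "\<bar>h2 y\<bar> \<le> \<epsilon> / 2 * norm (w - z)" using z0 by simp
      qed
      have "norm (h w - h z) \<le> (2 * (\<epsilon> / 2 * norm (w - z))) * norm (w - z)"
        by (rule differentiable_bound[OF C(1) has_derivative_at_withinI[OF h[OF subsetD[OF C(4)]]] onorm C(3,2)])
          (simp_all only: first)
      then show "\<bar>h w - h z\<bar> \<le> \<epsilon> * (norm (w - z))\<^sup>2" by (simp add: power2_eq_square mult.assoc)
    qed
  qed
  then have "negligible (h ` (?E \<inter> ball x r))"
    by (rule negligible_subset) (auto simp: K_def)
  then show "\<exists>V. open V \<and> x \<in> V \<and> negligible (h ` (?E \<inter> V))"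
    using r(1) by (intro exI[of _ "ball x r"]) auto
qed

text \<open>Where the first derivative \<open>k\<close> of \<open>h\<close> has nonzero derivative, the zero set of \<open>k\<close>, which contains the
  critical points of \<open>h\<close>, is locally a Lipschitz graph over a line, along which \<open>h\<close> has derivative 0.\<close>

lemma negligible_image_curve_critical:
  fixes h k :: "complex \<Rightarrow> real"
  assumes U: "open U"
    and h: "\<And>z. z \<in> E \<Longrightarrow> (h has_derivative (\<lambda>_. 0)) (at z)"
    and EU: "E \<subseteq> U" and k0: "\<And>z. z \<in> E \<Longrightarrow> k z = 0"
    and k: "\<And>z. z \<in> U \<Longrightarrow> (k has_derivative (\<lambda>v. Re v * k1 z + Im v * k2 z)) (at z)"
    and cont: "continuous_on U k1" "continuous_on U k2"
    and neq: "\<And>z. z \<in> E \<Longrightarrow> k1 z \<noteq> 0 \<or> k2 z \<noteq> 0"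
  shows "negligible (h ` E)"
proof (rule negligible_image_if_locally)
  fix x assume x: "x \<in> E"
  define n where "n = Complex (k1 x) (k2 x)"
  have n: "norm n > 0" using neq[OF x] by (auto simp: n_def complex_eq_iff)
  define \<eta> where "\<eta> = norm n / 4"
  have "isCont k1 x" "isCont k2 x"
    using cont U x EU by (auto simp: continuous_on_eq_continuous_at)
  then have lim: "(k1 \<longlongrightarrow> k1 x) (nhds x)" "(k2 \<longlongrightarrow> k2 x) (nhds x)"
    by (simp_all add: isCont_def tendsto_at_iff_tendsto_nhds)
  have "\<eta> > 0" using n by (simp add: \<eta>_def)
  with lim have "eventually (\<lambda>y. dist (k1 y) (k1 x) < \<eta>) (nhds x)" "eventually (\<lambda>y. dist (k2 y) (k2 x) < \<eta>) (nhds x)"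
    by (simp_all only: tendstoD)
  moreover have "eventually (\<lambda>y. y \<in> U) (nhds x)"
    using U x EU by (auto simp: eventually_nhds)
  ultimately have "eventually (\<lambda>y. dist (k1 y) (k1 x) < \<eta> \<and> dist (k2 y) (k2 x) < \<eta> \<and> y \<in> U) (nhds x)"
    by (intro eventually_conj)
  then obtain r where r: "r > 0" "\<And>y. y \<in> ball x r \<Longrightarrow> \<bar>k1 y - k1 x\<bar> < \<eta> \<and> \<bar>k2 y - k2 x\<bar> < \<eta> \<and> y \<in> U"
    unfolding eventually_nhds_metric by (auto simp: dist_real_def dist_commute)
  define F where "F = E \<inter> ball x r"
  define m where "m = sgn n"
  have m: "norm m = 1" using n by (simp add: m_def norm_sgn)
  have lip: "norm (z - w) \<le> 2 * \<bar>Im (cnj m * z) - Im (cnj m * w)\<bar>" if z: "z \<in> F" and w: "w \<in> F" for z w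
  proof -
    define f where "f = (\<lambda>y. k y - (Re y * k1 x + Im y * k2 x))"
    have "norm (f z - f w) \<le> (norm n / 2) * norm (z - w)"
    proof (rule differentiable_bound[of "ball x r" f "\<lambda>y v. Re v * k1 y + Im v * k2 y - (Re v * k1 x + Im v * k2 x)"])
      fix y assume y: "y \<in> ball x r"
      have "(f has_derivative (\<lambda>v. Re v * k1 y + Im v * k2 y - (Re v * k1 x + Im v * k2 x))) (at y)"
        unfolding f_def using k[of y] r(2)[OF y]
        by (auto intro!: derivative_eq_intros bounded_linear_imp_has_derivative[OF bounded_linear_Re] bounded_linear_imp_has_derivative[OF bounded_linear_Im])
      then show "(f has_derivative (\<lambda>v. Re v * k1 y + Im v * k2 y - (Re v * k1 x + Im v * k2 x))) (at y within ball x r)"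
        by (rule has_derivative_at_withinI)
      show "onorm (\<lambda>v. Re v * k1 y + Im v * k2 y - (Re v * k1 x + Im v * k2 x)) \<le> norm n / 2"
      proof (rule onorm_le)
        fix v :: complex
        have "\<bar>Re v * k1 y + Im v * k2 y - (Re v * k1 x + Im v * k2 x)\<bar> = \<bar>Re v * (k1 y - k1 x) + Im v * (k2 y - k2 x)\<bar>"
          by (simp add: algebra_simps)
        also have "\<dots> \<le> \<bar>Re v\<bar> * \<bar>k1 y - k1 x\<bar> + \<bar>Im v\<bar> * \<bar>k2 y - k2 x\<bar>"
          by (metis abs_mult abs_triangle_ineq)
        also have "\<dots> \<le> norm v * \<eta> + norm v * \<eta>"
          using r(2)[OF y] by (intro add_mono mult_mono abs_Re_le_cmod abs_Im_le_cmod) auto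
        finally show "norm (Re v * k1 y + Im v * k2 y - (Re v * k1 x + Im v * k2 x)) \<le> norm n / 2 * norm v"
          by (simp add: \<eta>_def)
      qed
    qed (use z w in \<open>auto simp: F_def\<close>)
    moreover have "f z - f w = - Re (cnj n * (z - w))"
      using k0 z w by (simp add: f_def F_def n_def algebra_simps)
    moreover have "cnj n = norm n * cnj m"
      using n by (simp add: m_def sgn_div_norm scaleR_conv_of_real)
    ultimately have "norm n * \<bar>Re (cnj m * (z - w))\<bar> \<le> norm n * (norm (z - w) / 2)"
      using n by (simp add: mult.assoc abs_mult)
    then have "\<bar>Re (cnj m * (z - w))\<bar> \<le> norm (z - w) / 2"
      using n by (simp add: mult_le_cancel_left)
    moreover have "norm (z - w) = norm (cnj m * (z - w))" using m by (simp add: norm_mult)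
    moreover have "\<dots> \<le> \<bar>Re (cnj m * (z - w))\<bar> + \<bar>Im (cnj m * (z - w))\<bar>" by (rule cmod_le)
    ultimately have "norm (z - w) \<le> 2 * \<bar>Im (cnj m * (z - w))\<bar>" by linarith
    then show ?thesis by (simp add: right_diff_distrib)
  qed
  define \<pi> where "\<pi> = (\<lambda>z. Im (cnj m * z))"
  define \<sigma> where "\<sigma> = inv_into F \<pi>"
  have lip': "norm (z - w) \<le> 2 * \<bar>\<pi> z - \<pi> w\<bar>" if "z \<in> F" "w \<in> F" for z w
    using lip[OF that] by (simp add: \<pi>_def)
  have "inj_on \<pi> F"
    using lip' by (force intro: inj_onI)
  then have \<sigma>: "\<sigma> (\<pi> z) = z" if "z \<in> F" for z using that by (simp add: \<sigma>_def)
  have "negligible ((h \<circ> \<sigma>) ` (\<pi> ` F))"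
  proof (rule negligible_image_if_derivative_zero)
    fix t assume "t \<in> \<pi> ` F"
    then obtain z where z: "z \<in> F" "t = \<pi> z" by auto
    show "((h \<circ> \<sigma>) has_derivative (\<lambda>_. 0)) (at t within \<pi> ` F)"
      unfolding has_derivative_within_alt
    proof (intro conjI allI impI)
      fix e :: real assume e: "e > 0"
      have "(h has_derivative (\<lambda>_. 0)) (at z within UNIV)" using h z by (simp add: F_def)
      then obtain d where d: "d > 0" "\<And>y. norm (y - z) < d \<Longrightarrow> norm (h y - h z) \<le> e / 2 * norm (y - z)"
        using e unfolding has_derivative_within_alt by (metis UNIV_I diff_zero half_gt_zero)
      show "\<exists>d>0. \<forall>s\<in>\<pi> ` F. norm (s - t) < d \<longrightarrow> norm ((h \<circ> \<sigma>) s - (h \<circ> \<sigma>) t - 0) \<le> e * norm (s - t)"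
      proof (intro exI[of _ "d / 2"] conjI ballI impI)
        fix s assume s: "s \<in> \<pi> ` F" "norm (s - t) < d / 2"
        then obtain y where y: "y \<in> F" "s = \<pi> y" by auto
        have yz: "norm (y - z) \<le> 2 * norm (s - t)" using lip'[OF y(1) z(1)] y z by simp
        then have "norm (h y - h z) \<le> e / 2 * norm (y - z)" using s by (intro d(2)) simp
        also have "\<dots> \<le> e / 2 * (2 * norm (s - t))" using yz e by (intro mult_left_mono) auto
        finally show "norm ((h \<circ> \<sigma>) s - (h \<circ> \<sigma>) t - 0) \<le> e * norm (s - t)"
          using y z by (simp add: \<sigma>)
      qed (use d in simp)
    qed simp
  qed
  moreover have "(h \<circ> \<sigma>) ` (\<pi> ` F) = h ` F" by (force simp: \<sigma> image_iff)
  ultimately have "negligible (h ` (E \<inter> ball x r))" by (simp add: F_def)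
  then show "\<exists>V. open V \<and> x \<in> V \<and> negligible (h ` (E \<inter> V))"
    using r(1) by (intro exI[of _ "ball x r"]) auto
qed

text \<open>A critical point is one where all second derivatives vanish, or it lies on a regular part of the zero
  set of one of the two partial derivatives.\<close>

theorem Sard_two_variables:
  fixes h :: "complex \<Rightarrow> real"
  assumes U: "open U" and h: "C_on 2 U h"
  shows "negligible (h ` {z \<in> U. (h has_derivative (\<lambda>_. 0)) (at z)})"
proof -
  have split: "frechet_derivative f (at z) = (\<lambda>v. Re v * frechet_derivative f (at z) 1 + Im v * frechet_derivative f (at z) \<i>)"
    if "f differentiable (at z)" for f :: "complex \<Rightarrow> real" and z
  proof
    fix v
    have lin: "linear (frechet_derivative f (at z))"
      using that by (rule linear_frechet_derivative)
    have "frechet_derivative f (at z) (Re v *\<^sub>R 1 + Im v *\<^sub>R \<i>) =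
        Re v * frechet_derivative f (at z) 1 + Im v * frechet_derivative f (at z) \<i>"
      by (simp only: linear_add[OF lin] linear_scale[OF lin] real_scaleR_def)
    moreover have "Re v *\<^sub>R 1 + Im v *\<^sub>R \<i> = v" by (simp add: complex_eq_iff)
    ultimately show "frechet_derivative f (at z) v = Re v * frechet_derivative f (at z) 1 + Im v * frechet_derivative f (at z) \<i>"
      by simp
  qed
  have deriv: "(f has_derivative (\<lambda>v. Re v * frechet_derivative f (at z) 1 + Im v * frechet_derivative f (at z) \<i>)) (at z)"
    if "f differentiable (at z)" for f :: "complex \<Rightarrow> real" and z
    using that split[OF that] by (metis frechet_derivative_works)
  define h1 where "h1 = (\<lambda>z. frechet_derivative h (at z) 1)"
  define h2 where "h2 = (\<lambda>z. frechet_derivative h (at z) \<i>)"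
  define h11 where "h11 = (\<lambda>z. frechet_derivative h1 (at z) 1)"
  define h12 where "h12 = (\<lambda>z. frechet_derivative h1 (at z) \<i>)"
  define h21 where "h21 = (\<lambda>z. frechet_derivative h2 (at z) 1)"
  define h22 where "h22 = (\<lambda>z. frechet_derivative h2 (at z) \<i>)"
  have diff: "h differentiable (at z)" "h1 differentiable (at z)" "h2 differentiable (at z)" if "z \<in> U" for z
    using h that by (auto simp: numeral_2_eq_2 h1_def h2_def)
  have cont: "continuous_on U h11" "continuous_on U h12" "continuous_on U h21" "continuous_on U h22"
    using h by (auto simp: numeral_2_eq_2 h1_def h2_def h11_def h12_def h21_def h22_def)
  have dh: "(h has_derivative (\<lambda>v. Re v * h1 z + Im v * h2 z)) (at z)"
    and dh1: "(h1 has_derivative (\<lambda>v. Re v * h11 z + Im v * h12 z)) (at z)"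
    and dh2: "(h2 has_derivative (\<lambda>v. Re v * h21 z + Im v * h22 z)) (at z)" if "z \<in> U" for z
    using deriv[OF diff(1)[OF that]] deriv[OF diff(2)[OF that]] deriv[OF diff(3)[OF that]]
    by (simp_all add: h1_def h2_def h11_def h12_def h21_def h22_def)
  have crit: "h1 z = 0 \<and> h2 z = 0" if "(h has_derivative (\<lambda>_. 0)) (at z)" for z
    using frechet_derivative_at[OF that, symmetric] by (simp add: h1_def h2_def)
  define Z where "Z = {z \<in> U. (h has_derivative (\<lambda>_. 0)) (at z)}"
  have sub: "h ` Z \<subseteq> h ` {z \<in> U. h1 z = 0 \<and> h2 z = 0 \<and> h11 z = 0 \<and> h12 z = 0 \<and> h21 z = 0 \<and> h22 z = 0}
      \<union> h ` {z \<in> Z. h11 z \<noteq> 0 \<or> h12 z \<noteq> 0} \<union> h ` {z \<in> Z. h21 z \<noteq> 0 \<or> h22 z \<noteq> 0}"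
    using crit by (auto simp: Z_def)
  have neg1: "negligible (h ` {z \<in> Z. h11 z \<noteq> 0 \<or> h12 z \<noteq> 0})"
    by (rule negligible_image_curve_critical[OF U _ _ _ dh1 cont(1,2)]) (use crit in \<open>auto simp: Z_def\<close>)
  have neg2: "negligible (h ` {z \<in> Z. h21 z \<noteq> 0 \<or> h22 z \<noteq> 0})"
    by (rule negligible_image_curve_critical[OF U _ _ _ dh2 cont(3,4)]) (use crit in \<open>auto simp: Z_def\<close>)
  show ?thesis
    unfolding Z_def[symmetric]
    by (rule negligible_subset[OF negligible_Un[OF negligible_Un[OF negligible_image_flat_critical[OF U dh dh1 dh2 cont] neg1] neg2] sub])
qed

section \<open>Charts of the flat torus\<close>

lemma Ints_Times_Ints_add: "z \<in> \<int> \<times> \<int> \<Longrightarrow> w \<in> \<int> \<times> \<int> \<Longrightarrow> z + w \<in> \<int> \<times> (\<int> :: real set)"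
  by (auto simp: mem_Times_iff)

lemma Ints_Times_Ints_diff: "z \<in> \<int> \<times> \<int> \<Longrightarrow> w \<in> \<int> \<times> \<int> \<Longrightarrow> z - w \<in> \<int> \<times> (\<int> :: real set)"
  by (auto simp: mem_Times_iff)

lemma Ints_Times_Ints_minus: "z \<in> \<int> \<times> \<int> \<Longrightarrow> - z \<in> \<int> \<times> (\<int> :: real set)"
  by (auto simp: mem_Times_iff)

lemma Ints_abs_less_1: "x \<in> \<int> \<Longrightarrow> \<bar>x\<bar> < 1 \<Longrightarrow> x = (0::real)"
  by (metis Ints_nonzero_abs_ge1 linorder_not_le)

lemma Ints_Times_Ints_norm_less_1:
  fixes z :: "real \<times> real"
  assumes "z \<in> \<int> \<times> \<int>" "norm z < 1"
  shows "z = 0"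
proof -
  have "\<bar>fst z\<bar> < 1" "\<bar>snd z\<bar> < 1"
    using norm_fst_le[of "fst z" "snd z"] norm_snd_le[of "snd z" "fst z"] assms(2) by auto
  then show ?thesis
    using assms(1) by (auto simp: mem_Times_iff prod_eq_iff intro: Ints_abs_less_1)
qed

lemma in_torus_proj_iff: "y \<in> torus_proj x \<longleftrightarrow> y - x \<in> \<int> \<times> \<int>"
proof
  assume "y - x \<in> \<int> \<times> \<int>"
  then show "y \<in> torus_proj x"
    unfolding torus_proj_def by (intro CollectI exI[of _ "y - x"]) auto
qed (auto simp: torus_proj_def)

lemma torus_proj_eq_iff: "torus_proj x = torus_proj y \<longleftrightarrow> x - y \<in> \<int> \<times> \<int>"
proof
  assume "torus_proj x = torus_proj y"
  then show "x - y \<in> \<int> \<times> \<int>"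
    using in_torus_proj_iff[of x x] in_torus_proj_iff[of x y] by (simp add: zero_prod_def)
next
  assume *: "x - y \<in> \<int> \<times> \<int>"
  have "w - x \<in> \<int> \<times> \<int> \<longleftrightarrow> w - y \<in> \<int> \<times> \<int>" for w
    using Ints_Times_Ints_add[OF _ *, of "w - x"] Ints_Times_Ints_diff[OF _ *, of "w - y"]
    by (auto simp: algebra_simps)
  then show "torus_proj x = torus_proj y"
    by (auto simp: set_eq_iff in_torus_proj_iff)
qed

lemma mem_unit_box_iff:
  fixes a x :: "real \<times> real"
  shows "x \<in> box a (a + (1, 1)) \<longleftrightarrow>
     fst a < fst x \<and> fst x < fst a + 1 \<and> snd a < snd x \<and> snd x < snd a + 1"
  by (auto simp: box_prod box_real mem_Times_iff simp flip: prod.collapse)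

text \<open>Two points of an open unit square that differ by an integer vector are equal, so the
  projection is injective there and each chart of the torus inverts it.\<close>

lemma torus_cmap_proj:
  assumes "x \<in> box a (a + (1, 1))"
  shows "cmap torus a (torus_proj x) = x"
proof -
  have "(THE y. y \<in> torus_proj x \<and> y \<in> box a (a + (1, 1))) = x"
  proof (rule the_equality)
    show "x \<in> torus_proj x \<and> x \<in> box a (a + (1, 1))"
      using assms by (simp add: in_torus_proj_iff zero_prod_def)
    fix y assume y: "y \<in> torus_proj x \<and> y \<in> box a (a + (1, 1))"
    then have "fst (y - x) \<in> \<int>" "snd (y - x) \<in> \<int>"
      by (auto simp: in_torus_proj_iff mem_Times_iff)
    moreover have "\<bar>fst (y - x)\<bar> < 1" "\<bar>snd (y - x)\<bar> < 1"
      using y assms by (auto simp: mem_unit_box_iff)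
    ultimately have "fst (y - x) = 0" "snd (y - x) = 0"
      by (auto dest: Ints_abs_less_1)
    then show "y = x" by (simp add: prod_eq_iff)
  qed
  then show ?thesis by (simp add: torus_def)
qed

lemma torus_cdom: "cdom torus a = torus_proj ` box a (a + (1, 1))"
  by (simp add: torus_def)

lemma torus_cmap_image: "cmap torus a ` cdom torus a = box a (a + (1, 1))"
  by (force simp: torus_cdom torus_cmap_proj image_iff)

lemma torus_inj_cmap: "inj_on (cmap torus a) (cdom torus a)"
  by (auto simp: inj_on_def torus_cdom torus_cmap_proj)

lemma torus_cinv:
  assumes "x \<in> box a (a + (1, 1))"
  shows "cinv torus a x = torus_proj x"
proof -
  have "cinv torus a (cmap torus a (torus_proj x)) = torus_proj x"
    unfolding cinv_def using assms by (intro inv_into_f_f torus_inj_cmap) (auto simp: torus_cdom)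
  then show ?thesis using assms by (simp add: torus_cmap_proj)
qed

lemma torus_proj_cmap: "q \<in> cdom torus a \<Longrightarrow> torus_proj (cmap torus a q) = q"
  by (auto simp: torus_cdom torus_cmap_proj)

lemma idx_torus: "idx torus = UNIV"
  by (simp add: torus_def)

lemma open_unit_box: "open (box a (a + (1, 1)) :: (real \<times> real) set)"
  by (rule open_box)

lemma mem_centred_unit_box:
  fixes x :: "real \<times> real"
  shows "x \<in> box (x - (1/2, 1/2)) (x - (1/2, 1/2) + (1, 1))"
  by (auto simp: mem_unit_box_iff)

lemma torus_proj_in_centred_cdom: "torus_proj x \<in> cdom torus (x - (1/2, 1/2))"
  using mem_centred_unit_box by (auto simp: torus_cdom)

lemma points_torus: "points torus = range torus_proj"
proof -
  have "torus_proj x \<in> points torus" for x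
    using torus_proj_in_centred_cdom[of x] unfolding points_def idx_torus by blast
  then show ?thesis by (auto simp: points_def torus_cdom)
qed

text \<open>The transition from one lift to another is a translation by an integer vector.\<close>

lemma torus_cmap_near:
  assumes "torus_proj x \<in> cdom torus a"
  obtains r where "r > 0"
    "\<And>v. norm v < r \<Longrightarrow> torus_proj (x + v) \<in> cdom torus a"
    "\<And>v. norm v < r \<Longrightarrow> cmap torus a (torus_proj (x + v)) = cmap torus a (torus_proj x) + v"
proof -
  obtain y where y: "y \<in> box a (a + (1, 1))" "torus_proj x = torus_proj y"
    using assms by (auto simp: torus_cdom)
  obtain r where r: "r > 0" "ball y r \<subseteq> box a (a + (1, 1))"
    using open_unit_box y(1) openE by blast
  have *: "torus_proj (x + v) = torus_proj (y + v)" for v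
    using y(2) by (simp add: torus_proj_eq_iff)
  show thesis
  proof (rule that[OF r(1)])
    fix v :: "real \<times> real" assume "norm v < r"
    then have "y + v \<in> box a (a + (1, 1))" using r(2) by (auto simp: dist_norm)
    then show "torus_proj (x + v) \<in> cdom torus a"
      "cmap torus a (torus_proj (x + v)) = cmap torus a (torus_proj x) + v"
      using y by (auto simp: torus_cdom * torus_cmap_proj)
  qed
qed

section \<open>Isometries of the flat torus\<close>

text \<open>A map with orthogonal derivative whose inverse is differentiable preserves distances on
  small balls: it and its inverse are both 1-Lipschitz. Polarization then makes it agree with
  its derivative.\<close>

lemma locally_affine_if_derivative_orthogonal:
  fixes F G :: "'a::euclidean_space \<Rightarrow> 'a"
  assumes U: "open U" and V: "open V" and FV: "F ` U = V" and GF: "\<And>x. x \<in> U \<Longrightarrow> G (F x) = x"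
    and dF: "\<And>x. x \<in> U \<Longrightarrow> (F has_derivative F' x) (at x)"
    and dG: "\<And>y. y \<in> V \<Longrightarrow> G differentiable (at y)"
    and orth: "\<And>x v. x \<in> U \<Longrightarrow> norm (F' x v) = norm v"
    and x: "x \<in> U"
  obtains r where "r > 0" "\<And>v. norm v < r \<Longrightarrow> x + v \<in> U \<and> F (x + v) = F x + F' x v"
proof -
  have normG: "onorm (frechet_derivative G (at (F y))) \<le> 1" if "y \<in> U" for y
  proof -
    define G' where "G' = frechet_derivative G (at (F y))"
    have G': "(G has_derivative G') (at (F y))"
      using dG that FV frechet_derivative_works unfolding G'_def by blast
    have "((G \<circ> F) has_derivative (G' \<circ> F' y)) (at y)"
      by (rule diff_chain_at[OF dF[OF that] G'])
    moreover have "((G \<circ> F) has_derivative id) (at y)"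
      using U that GF by (intro has_derivative_transform_within_open[OF has_derivative_id U that]) auto
    ultimately have comp: "G' \<circ> F' y = id"
      using has_derivative_unique by blast
    have "linear (F' y)" using dF[OF that] has_derivative_linear by blast
    moreover have "inj (F' y)"
      using comp by (metis inj_on_id inj_on_imageI2)
    ultimately have "surj (F' y)"
      using linear_injective_imp_surjective by blast
    show ?thesis unfolding G'_def[symmetric]
    proof (rule onorm_le)
      fix w obtain v where "w = F' y v" using \<open>surj (F' y)\<close> by (metis surjD)
      then show "norm (G' w) \<le> 1 * norm w"
        using comp orth[OF that] by (metis comp_apply id_apply mult_1 order_refl)
    qed
  qed
  obtain r1 where r1: "r1 > 0" "ball x r1 \<subseteq> U" using U x openE by blast
  obtain r2 where r2: "r2 > 0" "ball (F x) r2 \<subseteq> V" using V x FV openE by blast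
  have lipF: "norm (F y - F z) \<le> 1 * norm (y - z)" if "y \<in> ball x r1" "z \<in> ball x r1" for y z
  proof (rule differentiable_bound[of "ball x r1" _ F'])
    fix w assume "w \<in> ball x r1"
    then have w: "w \<in> U" using r1 by blast
    show "(F has_derivative F' w) (at w within ball x r1)"
      using dF[OF w] by (rule has_derivative_at_withinI)
    show "onorm (F' w) \<le> 1"
      by (rule onorm_le) (simp add: orth[OF w])
  qed (use that in auto)
  have lipG: "norm (G y - G z) \<le> 1 * norm (y - z)" if "y \<in> ball (F x) r2" "z \<in> ball (F x) r2" for y z
  proof (rule differentiable_bound[of "ball (F x) r2" _ "\<lambda>y. frechet_derivative G (at y)"])
    fix w assume "w \<in> ball (F x) r2"
    then have w: "w \<in> V" using r2 by blast
    then show "onorm (frechet_derivative G (at w)) \<le> 1"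
      using normG FV by blast
    show "(G has_derivative frechet_derivative G (at w)) (at w within ball (F x) r2)"
      using dG[OF w] frechet_derivative_works has_derivative_at_withinI by blast
  qed (use that in auto)
  define r where "r = min r1 r2"
  have r: "r > 0" using r1 r2 by (simp add: r_def)
  define E where "E = (\<lambda>v. F (x + v) - F x)"
  have iso: "norm (E v - E w) = norm (v - w)" if "norm v < r" "norm w < r" for v w
  proof (rule antisym)
    have in1: "x + v \<in> ball x r1" "x + w \<in> ball x r1" "x \<in> ball x r1"
      using that r1 by (auto simp: r_def dist_norm)
    then show "norm (E v - E w) \<le> norm (v - w)"
      using lipF[of "x + v" "x + w"] by (simp add: E_def)
    have "norm (F (x + v) - F x) \<le> norm v" "norm (F (x + w) - F x) \<le> norm w"
      using lipF[OF in1(1) in1(3)] lipF[OF in1(2) in1(3)] by auto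
    then have "F (x + v) \<in> ball (F x) r2" "F (x + w) \<in> ball (F x) r2"
      using that by (auto simp: r_def dist_norm norm_minus_commute)
    from lipG[OF this] show "norm (v - w) \<le> norm (E v - E w)"
      using in1 r1 GF by (auto simp: E_def subset_iff)
  qed
  have E0: "E 0 = 0" by (simp add: E_def)
  have polar: "E v \<bullet> E w = v \<bullet> w" if "norm v < r" "norm w < r" for v w
  proof -
    have "norm (E v) = norm v" "norm (E w) = norm w"
      using iso[of v 0] iso[of w 0] that r E0 by auto
    with iso[OF that] show ?thesis
      by (simp add: dot_norm_neg)
  qed
  have "F (x + v) = F x + F' x v" if v: "norm v < r" for v
  proof -
    have "((\<lambda>s. E (s *\<^sub>R v)) has_derivative (\<lambda>s. F' x (s *\<^sub>R v))) (at 0)"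
    proof -
      have "((\<lambda>s. x + s *\<^sub>R v) has_derivative (\<lambda>s. s *\<^sub>R v)) (at 0)"
        by (auto intro!: derivative_eq_intros)
      from has_derivative_compose[OF this, of F "F' x"] dF[OF x] show ?thesis
        unfolding E_def by (intro has_derivative_eq_rhs[OF has_derivative_diff[OF _ has_derivative_const]]) auto
    qed
    then have "((\<lambda>s. E v \<bullet> E (s *\<^sub>R v)) has_derivative (\<lambda>s. E v \<bullet> F' x (s *\<^sub>R v))) (at 0)"
      by (rule has_derivative_inner_right)
    moreover have "((\<lambda>s. E v \<bullet> E (s *\<^sub>R v)) has_derivative (\<lambda>s. s * (v \<bullet> v))) (at 0)"
    proof (rule has_derivative_transform_within[where d=1 and f="\<lambda>s. s * (v \<bullet> v)"])
      fix s :: real assume "dist s 0 < 1"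
      then have "norm (s *\<^sub>R v) < r"
        using v mult_left_le_one_le[of "norm v" "\<bar>s\<bar>"] by simp
      then show "s * (v \<bullet> v) = E v \<bullet> E (s *\<^sub>R v)"
        using polar[OF v, of "s *\<^sub>R v"] by simp
    qed (auto intro!: derivative_eq_intros)
    ultimately have "(\<lambda>s. E v \<bullet> F' x (s *\<^sub>R v)) = (\<lambda>s. s * (v \<bullet> v))"
      using has_derivative_unique by blast
    from fun_cong[OF this, of 1] have "E v \<bullet> F' x v = v \<bullet> v" by simp
    moreover have "E v \<bullet> E v = v \<bullet> v" using polar v by blast
    moreover have "F' x v \<bullet> F' x v = v \<bullet> v" using orth[OF x] by (simp add: dot_square_norm)
    ultimately have "(E v - F' x v) \<bullet> (E v - F' x v) = 0"
      by (simp add: inner_diff_left inner_diff_right inner_commute)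
    then have "E v = F' x v" by simp
    then show ?thesis by (simp add: E_def algebra_simps)
  qed
  then show thesis
    using r r1 by (intro that[of r]) (auto simp: r_def dist_norm subset_iff)
qed

lemma torus_isometry_locally_affine:
  assumes iso: "riemannian_isometry torus flat_metric torus flat_metric \<phi>"
  obtains r A y where "r > 0" "orthogonal_transformation A"
    "\<And>v. norm v < r \<Longrightarrow> \<phi> (torus_proj (x + v)) = torus_proj (y + A v)"
proof -
  define \<psi> where "\<psi> = inv_into (points torus) \<phi>"
  have bij: "bij_betw \<phi> (points torus) (points torus)"
    and sm: "smooth_map torus torus \<phi>" "smooth_map torus torus \<psi>"
    and met: "\<And>a b q v w. q \<in> cdom torus a \<Longrightarrow> \<phi> q \<in> cdom torus b \<Longrightarrow>
        dmap torus torus \<phi> a b q v \<bullet> dmap torus torus \<phi> a b q w = v \<bullet> w"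
    using iso by (auto simp: riemannian_isometry_def flat_metric_def idx_torus \<psi>_def)
  have \<psi>\<phi>: "\<psi> (\<phi> q) = q" and \<phi>\<psi>: "\<phi> (\<psi> q) = q" if "q \<in> points torus" for q
    using bij that bij_betw_inv_into_left[OF bij] bij_betw_inv_into_right[OF bij] by (auto simp: \<psi>_def)
  have cdom_points: "cdom torus a \<subseteq> points torus" for a
    by (auto simp: points_def idx_torus)
  define a where "a = x - (1/2, 1/2)"
  have q: "torus_proj x \<in> cdom torus a"
    unfolding a_def by (rule torus_proj_in_centred_cdom)
  have xa: "x \<in> box a (a + (1, 1))"
    unfolding a_def by (rule mem_centred_unit_box)
  have "\<phi> (torus_proj x) \<in> points torus"
    using sm(1) subsetD[OF cdom_points q] unfolding smooth_map_def by blast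
  then obtain b where b: "\<phi> (torus_proj x) \<in> cdom torus b"
    by (auto simp: points_def)
  define U where "U = cmap torus a ` (cdom torus a \<inter> \<phi> -` cdom torus b)"
  define V where "V = cmap torus b ` (cdom torus b \<inter> \<psi> -` cdom torus a)"
  define F where "F = cmap torus b \<circ> \<phi> \<circ> cinv torus a"
  define G where "G = cmap torus a \<circ> \<psi> \<circ> cinv torus b"
  have cinv_cmap: "cinv torus c (cmap torus c p) = p" if "p \<in> cdom torus c" for p c
    using that by (simp add: cinv_def torus_inj_cmap)
  have F: "F (cmap torus a p) = cmap torus b (\<phi> p)" if "p \<in> cdom torus a" for p
    using that by (simp add: F_def cinv_cmap)
  have G: "G (cmap torus b p) = cmap torus a (\<psi> p)" if "p \<in> cdom torus b" for p
    using that by (simp add: G_def cinv_cmap)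
  have openU: "open U" and openV: "open V" and smF: "smooth_on U F" and smG: "smooth_on V G"
    using sm by (auto simp: smooth_map_def idx_torus U_def V_def F_def G_def)
  have diffF: "F differentiable (at y)" if "y \<in> U" for y
    using smF that C_on.simps(2)[of 0] unfolding smooth_on_def by blast
  have diffG: "G differentiable (at y)" if "y \<in> V" for y
    using smG that C_on.simps(2)[of 0] unfolding smooth_on_def by blast
  define F' where "F' = (\<lambda>y. frechet_derivative F (at y))"
  have F'_inner: "F' y v \<bullet> F' y w = v \<bullet> w" if "y \<in> U" for y v w
  proof -
    obtain p where "p \<in> cdom torus a" "\<phi> p \<in> cdom torus b" "y = cmap torus a p"
      using \<open>y \<in> U\<close> by (auto simp: U_def)
    then show ?thesis
      using met[of p a b v w] by (simp only: F'_def F_def dmap_def)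
  qed
  have dF: "(F has_derivative F' y) (at y)" if "y \<in> U" for y
    using diffF[OF that] frechet_derivative_works unfolding F'_def by blast
  have FUV: "F ` U = V"
  proof (intro equalityI subsetI)
    fix y assume "y \<in> F ` U"
    then obtain p where p: "p \<in> cdom torus a" "\<phi> p \<in> cdom torus b" "y = cmap torus b (\<phi> p)"
      by (auto simp: U_def F)
    then show "y \<in> V" using \<psi>\<phi>[of p] subsetD[OF cdom_points p(1)] by (auto simp: V_def)
  next
    fix y assume "y \<in> V"
    then obtain p where p: "p \<in> cdom torus b" "\<psi> p \<in> cdom torus a" "y = cmap torus b p"
      by (auto simp: V_def)
    then have "y = F (cmap torus a (\<psi> p))" "cmap torus a (\<psi> p) \<in> U"
      using \<phi>\<psi>[of p] subsetD[OF cdom_points p(1)] by (auto simp: U_def F)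
    then show "y \<in> F ` U" by blast
  qed
  have GF: "G (F y) = y" if "y \<in> U" for y
  proof -
    obtain p where p: "p \<in> cdom torus a" "\<phi> p \<in> cdom torus b" "y = cmap torus a p"
      using \<open>y \<in> U\<close> by (auto simp: U_def)
    then show ?thesis
      using \<psi>\<phi>[OF subsetD[OF cdom_points p(1)]] by (simp add: F G)
  qed
  have xU: "x \<in> U"
    unfolding U_def using q b torus_cmap_proj[OF xa] by (metis IntI image_eqI vimageI)
  obtain r where r: "r > 0" "\<And>v. norm v < r \<Longrightarrow> x + v \<in> U \<and> F (x + v) = F x + F' x v"
    using locally_affine_if_derivative_orthogonal[OF openU openV FUV GF dF diffG _ xU]
      F'_inner by (metis norm_eq)
  show thesis
  proof (rule that[OF r(1)])
    show "orthogonal_transformation (F' x)"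
      using F'_inner[OF xU] has_derivative_linear[OF dF[OF xU]]
      by (simp add: orthogonal_transformation_def)
    fix v :: "real \<times> real" assume v: "norm v < r"
    then obtain p where p: "p \<in> cdom torus a" "\<phi> p \<in> cdom torus b" "x + v = cmap torus a p"
      using r(2)[OF v] unfolding U_def by blast
    then have "\<phi> (torus_proj (x + v)) = torus_proj (F (x + v))"
      by (simp add: torus_proj_cmap F)
    then show "\<phi> (torus_proj (x + v)) = torus_proj (F x + F' x v)"
      using r(2)[OF v] by simp
  qed
qed

text \<open>An isometry determines its linear part at every point, because a linear map with integer
  values near the origin vanishes; the linear part is therefore locally constant.\<close>

lemma linear_part_unique:
  assumes "linear A" "linear B" "r > 0"
    and eq: "\<And>v::real \<times> real. norm v < r \<Longrightarrow> torus_proj (y + A v) = torus_proj (z + B v)"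
  shows "A = B"
proof
  fix w
  define D where "D = (\<lambda>v. A v - B v)"
  have linD: "linear D" unfolding D_def using assms by (intro linear_compose_sub)
  have DZ: "D v \<in> \<int> \<times> \<int>" if "norm v < r" for v
  proof -
    have "(y + A v) - (z + B v) \<in> \<int> \<times> \<int>" "(y + A 0) - (z + B 0) \<in> \<int> \<times> \<int>"
      using eq[OF that] eq[of 0] \<open>r > 0\<close> by (simp_all add: torus_proj_eq_iff)
    from Ints_Times_Ints_diff[OF this] show ?thesis
      using assms(1,2) by (simp add: D_def linear_0 algebra_simps)
  qed
  define s where "s = min r 1 / (norm w + norm (D w) + 1)"
  have pos: "norm w + norm (D w) + 1 > 0" by (simp add: add_nonneg_pos)
  have s: "s > 0" using \<open>r > 0\<close> pos by (simp add: s_def)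
  have s': "s * (norm w + norm (D w) + 1) = min r 1" using pos by (simp add: s_def)
  have "s * norm w \<ge> 0" "s * norm (D w) \<ge> 0" using s by auto
  then have "norm (s *\<^sub>R w) < r" "norm (s *\<^sub>R D w) < 1"
    using s s' norm_scaleR[of s w] norm_scaleR[of s "D w"] unfolding distrib_left by linarith+
  then have "D (s *\<^sub>R w) = 0"
    using DZ[of "s *\<^sub>R w"] linD by (intro Ints_Times_Ints_norm_less_1) (auto simp: linear_scale)
  then have "s *\<^sub>R D w = 0" using linD by (simp add: linear_scale)
  then show "A w = B w" using s by (simp add: D_def)
qed

lemma torus_proj_add: "torus_proj (x + c) = (\<lambda>z. z + c) ` torus_proj x"
proof (intro equalityI subsetI)
  fix w assume "w \<in> torus_proj (x + c)"
  then have "w - c \<in> torus_proj x" by (simp add: in_torus_proj_iff algebra_simps)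
  then show "w \<in> (\<lambda>z. z + c) ` torus_proj x" by (intro image_eqI[of _ _ "w - c"]) auto
qed (auto simp: in_torus_proj_iff)

text \<open>Isometries in the form in which they are used below: covered by an affine map \<open>x \<mapsto> b + A x\<close> of the plane.\<close>

locale affine_torus_map =
  fixes \<phi> :: "torus_point \<Rightarrow> torus_point" and A :: "real \<times> real \<Rightarrow> real \<times> real" and b
  assumes orth: "orthogonal_transformation A"
    and lift: "\<phi> (torus_proj x) = torus_proj (b + A x)"
    and inj_\<phi>: "inj_on \<phi> (range torus_proj)"

text \<open>The linear part and then the translation part of the local affine form are locally constant on
  the plane, which is connected.\<close>

lemma torus_isometry_affine:
  assumes iso: "riemannian_isometry torus flat_metric torus flat_metric \<phi>"
  obtains A b where "affine_torus_map \<phi> A b"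
proof -
  define P where "P = (\<lambda>x A. orthogonal_transformation A \<and>
    (\<exists>r>0. \<exists>y. \<forall>v. norm v < r \<longrightarrow> \<phi> (torus_proj (x + v)) = torus_proj (y + A v)))"
  have ex: "\<exists>A. P x A" for x
    using torus_isometry_locally_affine[OF iso, of x] unfolding P_def by metis
  have uniq: "A = B" if "P x A" "P x B" for x A B
  proof -
    obtain r s y z where *: "r > 0" "s > 0" "\<And>v. norm v < r \<Longrightarrow> \<phi> (torus_proj (x + v)) = torus_proj (y + A v)"
      "\<And>v. norm v < s \<Longrightarrow> \<phi> (torus_proj (x + v)) = torus_proj (z + B v)"
      using \<open>P x A\<close> \<open>P x B\<close> unfolding P_def by blast
    show ?thesis
    proof (rule linear_part_unique[of _ _ "min r s" y z])
      show "linear A" "linear B"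
        using that by (auto simp: P_def orthogonal_transformation_linear)
      show "torus_proj (y + A v) = torus_proj (z + B v)" if "norm v < min r s" for v
        using *(3,4)[of v] that by simp
    qed (use * in simp)
  qed
  have near: "\<exists>r>0. \<forall>h. norm h < r \<longrightarrow> P (x + h) A \<and>
      (\<exists>y. \<phi> (torus_proj x) = torus_proj y \<and> \<phi> (torus_proj (x + h)) = torus_proj (y + A h))"
    if PxA: "P x A" for x A
  proof -
    obtain r y where *: "r > 0" "\<And>v. norm v < r \<Longrightarrow> \<phi> (torus_proj (x + v)) = torus_proj (y + A v)"
      using PxA unfolding P_def by blast
    have lin: "linear A" using PxA by (simp add: P_def orthogonal_transformation_linear)
    have "P (x + h) A" if h: "norm h < r" for h :: "real \<times> real"
      unfolding P_def
    proof (intro conjI exI[of _ "r - norm h"] exI[of _ "y + A h"] allI impI)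
      show "orthogonal_transformation A" using PxA by (simp add: P_def)
      show "0 < r - norm h" using h by simp
      fix v :: "real \<times> real" assume "norm v < r - norm h"
      then have "norm (h + v) < r" using norm_triangle_ineq[of h v] by simp
      from *(2)[OF this] show "\<phi> (torus_proj (x + h + v)) = torus_proj (y + A h + A v)"
        using lin by (simp add: linear_add add.assoc)
    qed
    moreover have "\<phi> (torus_proj x) = torus_proj y"
      using *(2)[of 0] *(1) lin by (simp add: linear_0)
    ultimately show ?thesis using * by blast
  qed
  define L where "L = (\<lambda>x. THE A. P x A)"
  have L: "P x (L x)" for x
    unfolding L_def using ex uniq by (metis the_equality)
  have "L x = L 0" for x
  proof (rule connected_local_const[where f = L and A = UNIV])
    show "\<forall>a\<in>UNIV. \<forall>\<^sub>F c in at a. L a = L c"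
    proof
      fix a
      obtain r where r: "r > 0" "\<And>h. norm h < r \<Longrightarrow> P (a + h) (L a)"
        using near[OF L[of a]] by blast
      then have "L a = L c" if "dist c a < r" for c
        using r(2)[of "c - a"] that L[of c] uniq by (metis add.commute diff_add_cancel dist_norm)
      then show "\<forall>\<^sub>F c in at a. L a = L c"
        using r(1) by (auto simp: eventually_at)
    qed
  qed auto
  then have P: "P x (L 0)" for x
    using L by metis
  define A where "A = L 0"
  have orth: "orthogonal_transformation A" and lin: "linear A"
    using P unfolding A_def P_def by (auto simp: orthogonal_transformation_linear)
  have g': "(\<lambda>z. z + A x) ` (\<lambda>z. z - A x) ` Q = Q" for x Q
    by (simp add: image_image)
  \<comment> \<open>the translation part modulo integer vectors, in a form that needs no choice of a lift\<close>
  define g where "g = (\<lambda>x. (\<lambda>z. z - A x) ` \<phi> (torus_proj x))"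
  have "g x = g 0" for x
  proof (rule connected_local_const[where f = g and A = UNIV])
    show "\<forall>a\<in>UNIV. \<forall>\<^sub>F c in at a. g a = g c"
    proof
      fix a
      obtain r where r: "r > 0" "\<And>h. norm h < r \<Longrightarrow>
          \<exists>y. \<phi> (torus_proj a) = torus_proj y \<and> \<phi> (torus_proj (a + h)) = torus_proj (y + A h)"
        using near[OF P[of a]] unfolding A_def by blast
      have "g a = g c" if c: "dist c a < r" for c
      proof -
        obtain y where "\<phi> (torus_proj a) = torus_proj y"
          "\<phi> (torus_proj (a + (c - a))) = torus_proj (y + A (c - a))"
          using r(2)[of "c - a"] c unfolding dist_norm by blast
        then show ?thesis
          using lin by (auto simp: g_def torus_proj_add image_image linear_diff)
      qed
      then show "\<forall>\<^sub>F c in at a. g a = g c"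
        using r(1) by (auto simp: eventually_at)
    qed
  qed auto
  moreover obtain b where "\<phi> (torus_proj 0) = torus_proj b"
    using near[OF P[of 0]] by (metis norm_zero)
  ultimately have "g x = torus_proj b" for x
    using lin by (simp add: g_def linear_0)
  then have "\<phi> (torus_proj x) = (\<lambda>z. z + A x) ` torus_proj b" for x
    unfolding g_def by (metis (no_types, lifting) g')
  then have "affine_torus_map \<phi> A b"
    using orth iso by unfold_locales
      (auto simp: torus_proj_add riemannian_isometry_def points_torus bij_betw_def)
  then show thesis by (rule that)
qed

context affine_torus_map
begin

lemma linear_A: "linear A"
  using orth by (rule orthogonal_transformation_linear)

lemma dmap_eq:
  assumes q: "q \<in> cdom torus a" and \<phi>q: "\<phi> q \<in> cdom torus c"
  shows "dmap torus torus \<phi> a c q = A"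
proof -
  define x where "x = cmap torus a q"
  have x: "x \<in> box a (a + (1, 1))" "q = torus_proj x"
    using q torus_cmap_image torus_proj_cmap unfolding x_def by blast+
  have "torus_proj (b + A x) \<in> cdom torus c" using \<phi>q x lift by simp
  then obtain r where r: "r > 0" "\<And>v. norm v < r \<Longrightarrow>
      cmap torus c (torus_proj (b + A x + v)) = cmap torus c (torus_proj (b + A x)) + v"
    by (rule torus_cmap_near) blast
  define W where "W = box a (a + (1, 1)) \<inter> ball x r"
  have "((\<lambda>y. cmap torus c (torus_proj (b + A x)) + A (y - x)) has_derivative A) (at x)"
    using linear_imp_has_derivative[OF linear_A, of "at x"]
    by (auto intro!: derivative_eq_intros simp: linear_diff[OF linear_A])
  then have "((cmap torus c \<circ> \<phi> \<circ> cinv torus a) has_derivative A) (at x)"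
  proof (rule has_derivative_transform_within_open)
    show "open W" by (auto simp: W_def)
    show "x \<in> W" using x r by (auto simp: W_def)
    fix y assume y: "y \<in> W"
    then have "norm (A (y - x)) < r"
      by (simp add: W_def orthogonal_transformation_norm[OF orth] dist_norm norm_minus_commute)
    from r(2)[OF this] y show "cmap torus c (torus_proj (b + A x)) + A (y - x) =
        (cmap torus c \<circ> \<phi> \<circ> cinv torus a) y"
      by (simp add: W_def torus_cinv lift linear_diff[OF linear_A])
  qed
  then show ?thesis
    unfolding dmap_def x_def[symmetric] by (rule frechet_derivative_at[symmetric])
qed

lemma cotangent_lift_eq: "cotangent_lift \<phi> (torus_proj x, p) = (torus_proj (b + A x), A p)"
proof -
  have "(THE p'. \<forall>a c v. torus_proj x \<in> cdom torus a \<and> \<phi> (torus_proj x) \<in> cdom torus c \<longrightarrow>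
      p' \<bullet> dmap torus torus \<phi> a c (torus_proj x) v = p \<bullet> v) = A p"
  proof (rule the_equality)
    show "\<forall>a c v. torus_proj x \<in> cdom torus a \<and> \<phi> (torus_proj x) \<in> cdom torus c \<longrightarrow>
        A p \<bullet> dmap torus torus \<phi> a c (torus_proj x) v = p \<bullet> v"
    proof (intro allI impI)
      fix a c v assume "torus_proj x \<in> cdom torus a \<and> \<phi> (torus_proj x) \<in> cdom torus c"
      then show "A p \<bullet> dmap torus torus \<phi> a c (torus_proj x) v = p \<bullet> v"
        using orth by (simp add: dmap_eq orthogonal_transformation_def)
    qed
    fix p' assume *: "\<forall>a c v. torus_proj x \<in> cdom torus a \<and> \<phi> (torus_proj x) \<in> cdom torus c \<longrightarrow>
        p' \<bullet> dmap torus torus \<phi> a c (torus_proj x) v = p \<bullet> v"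
    have "torus_proj x \<in> cdom torus (x - (1/2, 1/2))"
      "\<phi> (torus_proj x) \<in> cdom torus (b + A x - (1/2, 1/2))"
      by (simp_all only: lift torus_proj_in_centred_cdom)
    note charts = this
    have "p' \<bullet> A v = A p \<bullet> A v" for v
    proof -
      have "p' \<bullet> A v = p \<bullet> v"
        using *[rule_format, OF conjI[OF charts], of v] by (simp only: dmap_eq[OF charts])
      also have "\<dots> = A p \<bullet> A v"
        using orth by (simp add: orthogonal_transformation_def)
      finally show ?thesis .
    qed
    then have "p' \<bullet> w = A p \<bullet> w" for w
      using orthogonal_transformation_surj[OF orth] by (metis surjD)
    then show "p' = A p" by (metis vector_eq_rdot)
  qed
  then show ?thesis by (simp add: cotangent_lift_def lift)
qed

end

section \<open>Points of the mapping torus\<close>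

locale injective_self_map =
  fixes X :: "'a set" and f :: "'a \<Rightarrow> 'a"
  assumes maps: "f ` X \<subseteq> X" and inj: "inj_on f X"
begin

lemma funpow_in: "x \<in> X \<Longrightarrow> (f ^^ n) x \<in> X"
  by (induction n) (use maps in auto)

lemma inj_funpow: "inj_on (f ^^ n) X"
proof (induction n)
  case (Suc n)
  have "inj_on f ((f ^^ n) ` X)"
    using inj by (rule inj_on_subset) (auto intro: funpow_in)
  from comp_inj_on[OF Suc this] show ?case by (simp add: comp_def)
qed auto

lemma equivclp_funpow: "x \<in> X \<Longrightarrow> equivclp (mt_step X f) (x, t) ((f ^^ n) x, t + real n)"
proof (induction n)
  case (Suc n)
  have "mt_step X f ((f ^^ n) x, t + real n) ((f ^^ Suc n) x, t + real (Suc n))"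
    using funpow_in[OF Suc.prems] by (simp add: mt_step_def)
  with Suc.IH[OF Suc.prems] show ?case by (blast intro: equivclp_into_equivclp)
qed simp

text \<open>Two points are equivalent iff they flow forward to a common point; this relation is transitive
  because one can flow further.\<close>

lemma equivclp_mt_step_iff:
  assumes y: "fst y \<in> X"
  shows "equivclp (mt_step X f) y z \<longleftrightarrow>
    fst z \<in> X \<and> (\<exists>m n. (f ^^ m) (fst y) = (f ^^ n) (fst z) \<and> snd y + real m = snd z + real n)"
    (is "_ \<longleftrightarrow> ?P z")
proof
  assume "equivclp (mt_step X f) y z"
  then show "?P z"
  proof (induction rule: equivclp_induct)
    case base
    show ?case using y by blast
  next
    case (step w z)
    then obtain m n where mn: "fst w \<in> X" "(f ^^ m) (fst y) = (f ^^ n) (fst w)"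
        "snd y + real m = snd w + real n"
      by blast
    from step.hyps(2) show ?case
    proof
      assume "mt_step X f w z"
      then have z: "z = (f (fst w), snd w + 1)" by (simp add: mt_step_def)
      have "(f ^^ Suc m) (fst y) = (f ^^ n) (fst z)"
        using mn z by (simp add: funpow_swap1)
      moreover have "snd y + real (Suc m) = snd z + real n" using mn z by simp
      moreover have "fst z \<in> X" using z mn maps by auto
      ultimately show ?thesis by blast
    next
      assume "mt_step X f z w"
      then have w: "fst z \<in> X" "w = (f (fst z), snd z + 1)" by (simp_all add: mt_step_def)
      have "(f ^^ m) (fst y) = (f ^^ Suc n) (fst z)"
        using mn w by (simp add: funpow_swap1)
      moreover have "snd y + real m = snd z + real (Suc n)" using mn w by simp
      ultimately show ?thesis using w by blast
    qed
  qed
next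
  assume "?P z"
  then obtain m n where mn: "fst z \<in> X" "(f ^^ m) (fst y) = (f ^^ n) (fst z)"
    "snd y + real m = snd z + real n"
    by blast
  have "equivclp (mt_step X f) y ((f ^^ n) (fst z), snd z + real n)"
    using equivclp_funpow[OF y, of "snd y" m] mn by simp
  moreover have "equivclp (mt_step X f) ((f ^^ n) (fst z), snd z + real n) z"
    using equivclp_funpow[OF mn(1), of "snd z" n] by (simp add: equivclp_sym)
  ultimately show "equivclp (mt_step X f) y z" by (rule equivclp_trans)
qed

lemma mt_proj_eq_iff:
  assumes "x \<in> X" "y \<in> X"
  shows "mt_proj X f (x, s) = mt_proj X f (y, t) \<longleftrightarrow>
    (\<exists>m n. (f ^^ m) x = (f ^^ n) y \<and> s + real m = t + real n)"
proof -
  have "mt_proj X f (x, s) = mt_proj X f (y, t) \<longleftrightarrow> equivclp (mt_step X f) (x, s) (y, t)"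
    unfolding mt_proj_def set_eq_iff mem_Collect_eq
    by (meson equivclp_refl equivclp_sym equivclp_trans)
  then show ?thesis using assms by (simp add: equivclp_mt_step_iff)
qed

lemma mt_proj_shift_eq_iff:
  assumes "x \<in> X" "y \<in> X"
  shows "mt_proj X f (x, s) = mt_proj X f (y, s + real k) \<longleftrightarrow> (f ^^ k) x = y"
proof
  assume "mt_proj X f (x, s) = mt_proj X f (y, s + real k)"
  then obtain m n where mn: "(f ^^ m) x = (f ^^ n) y" "s + real m = s + real k + real n"
    using assms by (auto simp: mt_proj_eq_iff)
  then have "m = n + k" by simp
  then have "(f ^^ n) ((f ^^ k) x) = (f ^^ n) y" using mn(1) by (simp add: funpow_add)
  then show "(f ^^ k) x = y"
    using inj_funpow[of n] funpow_in[OF assms(1)] assms(2) by (auto dest: inj_onD)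
next
  assume *: "(f ^^ k) x = y"
  show "mt_proj X f (x, s) = mt_proj X f (y, s + real k)"
    unfolding mt_proj_eq_iff[OF assms] using * by (intro exI[of _ k] exI[of _ 0]) simp
qed

lemma mt_rep_proj:
  assumes x: "x \<in> X" and s: "s \<in> {c<..<c + 1}"
  shows "mt_rep c (mt_proj X f (x, s)) = (x, s)"
  unfolding mt_rep_def
proof (rule the_equality)
  show "(x, s) \<in> mt_proj X f (x, s) \<and> snd (x, s) \<in> {c<..<c + 1}"
    using s by (simp add: mt_proj_def)
  fix z assume z: "z \<in> mt_proj X f (x, s) \<and> snd z \<in> {c<..<c + 1}"
  then obtain m n where mn: "fst z \<in> X" "(f ^^ m) x = (f ^^ n) (fst z)" "s + real m = snd z + real n"
    using x by (auto simp: mt_proj_def equivclp_mt_step_iff)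
  have "real m < real n + 1" "real n < real m + 1" using mn(3) z s by auto
  then have "m = n" by linarith
  then show "z = (x, s)"
    using mn inj_funpow[of n] x by (auto simp: prod_eq_iff dest: inj_onD)
qed

end

section \<open>Charts and canonical distribution of the mapping torus\<close>

lemma angle_unique:
  assumes "s \<in> {b<..<b + 2 * pi}" "t \<in> {b<..<b + 2 * pi}" "(cos s, sin s) = (cos t, sin t)"
  shows "s = t"
proof -
  obtain n :: int where n: "s = t + 2 * pi * n"
    using assms(3) sin_cos_eq_iff[of s t] by auto
  have "\<bar>2 * pi * n\<bar> < 2 * pi * 1" using assms(1,2) n by auto
  then have "\<bar>real_of_int n\<bar> < 1" by (simp add: abs_mult)
  then show ?thesis using n by simp
qed

lemma unit_cotangent_cmap:
  assumes "s \<in> {b<..<b + 2 * pi}"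
  shows "cmap unit_cotangent (a, b) (q, (cos s, sin s)) = (cmap torus a q, s)"
proof -
  have "(THE t. t \<in> {b<..<b + 2 * pi} \<and> (cos s, sin s) = (cos t, sin t)) = s"
    using assms angle_unique by (intro the_equality) auto
  then show ?thesis by (simp add: unit_cotangent_def)
qed

lemma unit_cotangent_cdom:
  "cdom unit_cotangent (a, b) = cdom torus a \<times> (\<lambda>s. (cos s, sin s)) ` {b<..<b + 2 * pi}"
  by (simp add: unit_cotangent_def)

lemma points_unit_cotangent: "points unit_cotangent = range torus_proj \<times> sphere 0 1"
proof (intro equalityI subsetI)
  fix z assume "z \<in> points unit_cotangent"
  then obtain a b where "z \<in> cdom unit_cotangent (a, b)"
    by (auto simp: points_def)
  then show "z \<in> range torus_proj \<times> sphere 0 1"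
    by (auto simp: unit_cotangent_cdom torus_cdom norm_Pair)
next
  fix z :: "torus_point \<times> (real \<times> real)" assume z: "z \<in> range torus_proj \<times> sphere 0 1"
  then obtain x where x: "fst z = torus_proj x" by auto
  have "(fst (snd z))\<^sup>2 + (snd (snd z))\<^sup>2 = 1"
    using z by (auto simp: norm_prod_def)
  then obtain s where s: "snd z = (cos s, sin s)"
    using sincos_total_2pi_le[of "fst (snd z)" "snd (snd z)"] by (metis prod.collapse)
  have "z \<in> cdom unit_cotangent (x - (1/2, 1/2), s - pi)"
    using x s torus_proj_in_centred_cdom[of x] unfolding unit_cotangent_cdom
    by (auto simp: mem_Times_iff)
  then show "z \<in> points unit_cotangent"
    unfolding points_def
    by (intro UN_I[of "(x - (1/2, 1/2), s - pi)"]) (simp_all add: unit_cotangent_def)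
qed

context affine_torus_map
begin

abbreviation M where
  "M \<equiv> mapping_torus unit_cotangent (cotangent_lift \<phi>)"

definition mt_point :: "real \<times> real \<Rightarrow> real \<times> real \<Rightarrow> real \<Rightarrow>
    ((torus_point \<times> (real \<times> real)) \<times> real) set" where
  "mt_point x p \<theta> = mt_proj (points unit_cotangent) (cotangent_lift \<phi>) ((torus_proj x, p), \<theta>)"

lemma mem_points_unit_cotangent: "(torus_proj x, p) \<in> points unit_cotangent \<longleftrightarrow> norm p = 1"
  by (auto simp: points_unit_cotangent)

lemma funpow_lift:
  "((cotangent_lift \<phi>) ^^ n) (torus_proj x, p) = (torus_proj (((\<lambda>x. b + A x) ^^ n) x), (A ^^ n) p)"
  by (induction n) (auto simp: cotangent_lift_eq)

sublocale self: injective_self_map "points unit_cotangent" "cotangent_lift \<phi>"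
proof
  show "cotangent_lift \<phi> ` points unit_cotangent \<subseteq> points unit_cotangent"
    by (auto simp: points_unit_cotangent cotangent_lift_eq orthogonal_transformation_norm[OF orth])
  show "inj_on (cotangent_lift \<phi>) (points unit_cotangent)"
  proof (rule inj_onI)
    fix y z assume yz: "y \<in> points unit_cotangent" "z \<in> points unit_cotangent"
      "cotangent_lift \<phi> y = cotangent_lift \<phi> z"
    obtain x p x' p' where *: "y = (torus_proj x, p)" "z = (torus_proj x', p')"
      using yz by (auto simp: points_unit_cotangent)
    have "\<phi> (torus_proj x) = \<phi> (torus_proj x')" "A p = A p'"
      using yz(3) by (simp_all add: * cotangent_lift_eq lift)
    then show "y = z"
      using inj_\<phi> orthogonal_transformation_inj[OF orth] by (simp add: * inj_on_def inj_def)
  qed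
qed

lemma idx_M: "idx M = UNIV"
  by (simp add: mapping_torus_def unit_cotangent_def)

text \<open>The image of a chart, and the point with coordinates \<open>((x, s), \<theta>)\<close>. The latter does not depend on
  the chart, so the inverses of all charts are restrictions of one map.\<close>

definition chart_coords :: "((real \<times> real) \<times> real) \<times> real \<Rightarrow> (((real \<times> real) \<times> real) \<times> real) set" where
  "chart_coords j = (box (fst (fst j)) (fst (fst j) + (1, 1)) \<times> {snd (fst j)<..<snd (fst j) + 2 * pi})
     \<times> {snd j<..<snd j + 1}"

definition chart_point :: "((real \<times> real) \<times> real) \<times> real \<Rightarrow>
    ((torus_point \<times> (real \<times> real)) \<times> real) set" where
  "chart_point \<xi> = mt_point (fst (fst \<xi>)) (cos (snd (fst \<xi>)), sin (snd (fst \<xi>))) (snd \<xi>)"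

lemma open_chart_coords: "open (chart_coords j)"
  unfolding chart_coords_def by (intro open_Times open_box open_greaterThanLessThan)

lemma chart_point_rep:
  assumes "\<xi> \<in> chart_coords j"
  shows "mt_rep (snd j) (chart_point \<xi>) =
    ((torus_proj (fst (fst \<xi>)), (cos (snd (fst \<xi>)), sin (snd (fst \<xi>)))), snd \<xi>)"
  unfolding chart_point_def mt_point_def
  by (rule self.mt_rep_proj)
    (use assms in \<open>auto simp: chart_coords_def points_unit_cotangent norm_Pair\<close>)

lemma cmap_chart_point:
  assumes "\<xi> \<in> chart_coords j"
  shows "cmap M j (chart_point \<xi>) = \<xi>"
proof -
  obtain a b' c where j: "j = ((a, b'), c)" by (metis prod.collapse)
  have *: "fst (fst \<xi>) \<in> box a (a + (1, 1))" "snd (fst \<xi>) \<in> {b'<..<b' + 2 * pi}"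
    using assms by (auto simp: chart_coords_def j)
  show ?thesis
    using chart_point_rep[OF assms] unit_cotangent_cmap[OF *(2)] torus_cmap_proj[OF *(1)]
    by (simp add: mapping_torus_def j)
qed

lemma cdom_M: "cdom M j = chart_point ` chart_coords j"
proof -
  obtain a b' c where j: "j = ((a, b'), c)" by (metis prod.collapse)
  have "cdom M j = mt_proj (points unit_cotangent) (cotangent_lift \<phi>) `
      (((torus_proj ` box a (a + (1, 1))) \<times> (\<lambda>s. (cos s, sin s)) ` {b'<..<b' + 2 * pi}) \<times> {c<..<c + 1})"
    by (simp add: mapping_torus_def j unit_cotangent_cdom torus_cdom)
  also have "\<dots> = chart_point ` chart_coords j"
    unfolding chart_point_def mt_point_def chart_coords_def j
    by (force simp: image_iff Bex_def)
  finally show ?thesis .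
qed

lemma cmap_in_chart_coords: "P \<in> cdom M j \<Longrightarrow> cmap M j P \<in> chart_coords j"
  and chart_point_cmap: "P \<in> cdom M j \<Longrightarrow> chart_point (cmap M j P) = P"
  by (auto simp: cdom_M cmap_chart_point)

lemma cinv_M: "\<xi> \<in> chart_coords j \<Longrightarrow> cinv M j \<xi> = chart_point \<xi>"
  unfolding cinv_def
  by (rule inv_into_f_eq) (auto simp: inj_on_def cdom_M cmap_chart_point)

lemma ext_deriv_liouville:
  assumes P: "P \<in> cdom M j" and s: "s = snd (fst (cmap M j P))"
  shows "ext_deriv M (mt_form liouville) j P v w =
    snd (fst v) * ((- sin s, cos s) \<bullet> fst (fst w)) - snd (fst w) * ((- sin s, cos s) \<bullet> fst (fst v))"
proof -
  have "frechet_derivative (\<lambda>\<xi>. mt_form liouville j (cinv M j \<xi>) w) (at (cmap M j P)) =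
      (\<lambda>v. snd (fst v) * ((- sin s, cos s) \<bullet> fst (fst w)))" for w
  proof (rule frechet_derivative_at[symmetric])
    obtain w1 w2 where w12: "fst (fst w) = (w1, w2)" by (metis prod.collapse)
    have "((\<lambda>\<xi>. (cos (snd (fst \<xi>)), sin (snd (fst \<xi>))) \<bullet> fst (fst w)) has_derivative
        (\<lambda>v. snd (fst v) * ((- sin s, cos s) \<bullet> fst (fst w)))) (at (cmap M j P))"
      unfolding w12 inner_Pair inner_real_def s
      by (auto intro!: derivative_eq_intros simp: algebra_simps)
    then show "((\<lambda>\<xi>. mt_form liouville j (cinv M j \<xi>) w) has_derivative
        (\<lambda>v. snd (fst v) * ((- sin s, cos s) \<bullet> fst (fst w)))) (at (cmap M j P))"
    proof (rule has_derivative_transform_within_open[OF _ open_chart_coords])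
      show "cmap M j P \<in> chart_coords j" using P by (rule cmap_in_chart_coords)
      fix \<xi> assume "\<xi> \<in> chart_coords j"
      then show "(cos (snd (fst \<xi>)), sin (snd (fst \<xi>))) \<bullet> fst (fst w) = mt_form liouville j (cinv M j \<xi>) w"
        using chart_point_rep[of \<xi> j]
        by (simp add: cinv_M mt_form_def liouville_def case_prod_unfold)
    qed
  qed
  then show ?thesis by (simp add: ext_deriv_def)
qed

text \<open>In the coordinates \<open>((x, s), \<theta>)\<close> of a chart, with \<open>p = (cos s, sin s)\<close>, the dual vectors are
  \<open>X\<^sub>\<alpha> = (p, 0, 0)\<close>, the Reeb field, and \<open>X\<^sub>\<lambda> = - \<partial>\<^sub>\<theta>\<close>. Testing a vector of the
  kernel of \<open>\<omega>\<close> against \<open>\<partial>\<^sub>\<theta>\<close>, \<open>\<partial>\<^sub>s\<close> and the two unit vectors \<open>p\<close> and \<open>p\<close> rotated shows that the dual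
  vectors are unique.\<close>

lemma canonical_distribution_M:
  assumes P: "P \<in> cdom M j" and s: "s = snd (fst (cmap M j P))"
  shows "canonical_distribution M (mt_form liouville) mt_dtheta j P =
    span {(((cos s, sin s), 0), 0), (((0, 0), 0), - 1)}"
proof -
  define \<omega> where "\<omega> = lcs_form M (mt_form liouville) mt_dtheta j P"
  have lam: "mt_form liouville j P v = (cos s, sin s) \<bullet> fst (fst v)" for v
    using chart_point_rep[OF cmap_in_chart_coords[OF P]] P
    by (simp add: mt_form_def liouville_def case_prod_unfold chart_point_cmap s)
  have \<omega>: "\<omega> v w = snd (fst v) * ((- sin s, cos s) \<bullet> fst (fst w)) - snd (fst w) * ((- sin s, cos s) \<bullet> fst (fst v))
      - (snd v * ((cos s, sin s) \<bullet> fst (fst w)) - snd w * ((cos s, sin s) \<bullet> fst (fst v)))" for v w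
    unfolding \<omega>_def lcs_form_def ext_deriv_liouville[OF P s] by (simp add: lam mt_dtheta_def)
  have cs: "cos s * cos s + sin s * sin s = 1"
    using sin_cos_squared_add[of s] by (simp add: power2_eq_square)
  have uniq: "X = Y" if XY: "\<And>w. \<omega> X w = \<omega> Y w" for X Y
  proof -
    obtain x1 x2 xs xt y1 y2 ys yt where X: "X = (((x1, x2), xs), xt)" and Y: "Y = (((y1, y2), ys), yt)"
      by (metis prod.collapse)
    define a where "a = x1 - y1"
    define c where "c = x2 - y2"
    have 1: "cos s * a + sin s * c = 0"
      using XY[of "(((0, 0), 0), 1)"] by (simp add: \<omega> X Y a_def c_def algebra_simps)
    have 2: "cos s * c = sin s * a"
      using XY[of "(((0, 0), 1), 0)"] by (simp add: \<omega> X Y a_def c_def algebra_simps)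
    have "(cos s * cos s + sin s * sin s) * a = 0" "(cos s * cos s + sin s * sin s) * c = 0"
      using 1 2 by algebra+
    then have "x1 = y1" "x2 = y2" unfolding cs by (simp_all add: a_def c_def)
    define d where "d = xs - ys"
    define e where "e = xt - yt"
    have 3: "- (d * sin s) - e * cos s = 0"
      using XY[of "(((1, 0), 0), 0)"] by (simp add: \<omega> X Y d_def e_def algebra_simps)
    have 4: "d * cos s - e * sin s = 0"
      using XY[of "(((0, 1), 0), 0)"] by (simp add: \<omega> X Y d_def e_def algebra_simps)
    have "(cos s * cos s + sin s * sin s) * d = 0" "(cos s * cos s + sin s * sin s) * e = 0"
      using 3 4 by algebra+
    then have "xs = ys" "xt = yt" unfolding cs by (simp_all add: d_def e_def)
    with \<open>x1 = y1\<close> \<open>x2 = y2\<close> show ?thesis by (simp add: X Y)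
  qed
  have "lcs_dual M (mt_form liouville) mt_dtheta mt_dtheta j P = (((cos s, sin s), 0), 0)"
    unfolding lcs_dual_def \<omega>_def[symmetric]
  proof (rule the_equality)
    show "\<forall>w. \<omega> (((cos s, sin s), 0), 0) w = mt_dtheta j P w"
      by (simp add: \<omega> mt_dtheta_def algebra_simps cs)
    then show "X = (((cos s, sin s), 0), 0)" if "\<forall>w. \<omega> X w = mt_dtheta j P w" for X
      using that by (intro uniq) simp
  qed
  moreover have "lcs_dual M (mt_form liouville) mt_dtheta (mt_form liouville) j P = (((0, 0), 0), - 1)"
    unfolding lcs_dual_def \<omega>_def[symmetric]
  proof (rule the_equality)
    show "\<forall>w. \<omega> (((0, 0), 0), - 1) w = mt_form liouville j P w"
      by (simp add: \<omega> lam)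
    then show "X = (((0, 0), 0), - 1)" if "\<forall>w. \<omega> X w = mt_form liouville j P w" for X
      using that by (intro uniq) simp
  qed
  ultimately show ?thesis by (simp add: canonical_distribution_def)
qed

lemma mem_canonical_distribution_M:
  assumes P: "P \<in> cdom M j" and s: "s = snd (fst (cmap M j P))"
  shows "v \<in> canonical_distribution M (mt_form liouville) mt_dtheta j P \<longleftrightarrow>
    (\<exists>t \<tau>. v = ((t *\<^sub>R (cos s, sin s), 0), \<tau>))"
proof -
  have "(v \<in> canonical_distribution M (mt_form liouville) mt_dtheta j P) =
     (\<exists>t \<tau>. v - t *\<^sub>R (((cos s, sin s), 0), 0) = \<tau> *\<^sub>R (((0, 0), 0), - 1))"
    unfolding canonical_distribution_M[OF assms] span_insert span_singleton by auto
  also have "\<dots> = (\<exists>t \<tau>. v = ((t *\<^sub>R (cos s, sin s), 0), \<tau>))"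
    by (rule ex_cong1) (cases v, auto simp: prod_eq_iff intro: exI[of _ "- snd v"])
  finally show ?thesis .
qed

lemma dim_canonical_distribution_M:
  assumes P: "P \<in> cdom M j"
  shows "dim (canonical_distribution M (mt_form liouville) mt_dtheta j P) = 2"
proof -
  define s where "s = snd (fst (cmap M j P))"
  have "(cos s, sin s) \<noteq> (0, 0)"
    using sin_cos_squared_add[of s] by (auto simp del: sin_cos_squared_add)
  then have "(((cos s, sin s), 0), 0) \<notin> span {(((0, 0), 0), - 1 :: real)}"
    by (auto simp: span_singleton)
  moreover have "(((0, 0), 0), - 1 :: real) \<noteq> (((0 :: real, 0 :: real), 0 :: real), 0)" by simp
  ultimately have "independent {(((cos s, sin s), 0), 0), (((0, 0), 0), - 1 :: real)}"
    by (simp add: independent_insert zero_prod_def)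
  from dim_span_eq_card_independent[OF this] \<open>(cos s, sin s) \<noteq> (0, 0)\<close> show ?thesis
    unfolding canonical_distribution_M[OF P s_def] by (simp add: numeral_2_eq_2)
qed

end

section \<open>Closed geodesics of the flat torus\<close>

lemma C_on_if_constant_derivative:
  assumes "open S" "\<And>x. x \<in> S \<Longrightarrow> (f has_derivative L) (at x)"
  shows "C_on k S f"
  using assms(2)
proof (induction k arbitrary: f L)
  case 0
  then show ?case
    by (auto intro!: has_derivative_continuous_on[where f' = "\<lambda>_. L"] intro: has_derivative_at_withinI)
next
  case (Suc k)
  have eq: "frechet_derivative f (at x) = L" if "x \<in> S" for x
    using frechet_derivative_at[OF Suc.prems[OF that]] by simp
  have "C_on k S (\<lambda>x. frechet_derivative f (at x) v)" for v
  proof (rule Suc.IH)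
    fix x assume "x \<in> S"
    then show "((\<lambda>x. frechet_derivative f (at x) v) has_derivative (\<lambda>_. 0)) (at x)"
      using eq \<open>open S\<close>
      by (intro has_derivative_transform_within_open[OF has_derivative_const[of "L v"], of S]) auto
  qed
  then show ?case
    using Suc.prems by (auto simp: differentiable_def)
qed

lemma line_has_derivative_in_chart:
  assumes "torus_proj (x + t *\<^sub>R p) \<in> cdom torus a"
  shows "((\<lambda>s. cmap torus a (torus_proj (x + s *\<^sub>R p))) has_derivative (\<lambda>h. h *\<^sub>R p)) (at t)"
    and "eventually (\<lambda>s. torus_proj (x + s *\<^sub>R p) \<in> cdom torus a) (nhds t)"
proof -
  obtain r where r: "r > 0" "\<And>v. norm v < r \<Longrightarrow> torus_proj (x + t *\<^sub>R p + v) \<in> cdom torus a"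
    "\<And>v. norm v < r \<Longrightarrow> cmap torus a (torus_proj (x + t *\<^sub>R p + v)) = cmap torus a (torus_proj (x + t *\<^sub>R p)) + v"
    using torus_cmap_near[OF assms] by blast
  define d where "d = r / (norm p + 1)"
  have np: "norm p + 1 > 0" by (simp add: add_nonneg_pos)
  have d: "d > 0" using r np by (simp add: d_def)
  have small: "norm ((s - t) *\<^sub>R p) < r" if "dist s t < d" for s
  proof -
    have "norm ((s - t) *\<^sub>R p) \<le> dist s t * (norm p + 1)"
      by (simp add: dist_real_def distrib_left)
    also have "\<dots> < d * (norm p + 1)" using that np by (intro mult_strict_right_mono)
    finally show ?thesis using np by (simp add: d_def)
  qed
  have eq: "x + s *\<^sub>R p = x + t *\<^sub>R p + (s - t) *\<^sub>R p" for s
    by (simp add: algebra_simps)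
  show "eventually (\<lambda>s. torus_proj (x + s *\<^sub>R p) \<in> cdom torus a) (nhds t)"
    unfolding eventually_nhds_metric
  proof (intro exI[of _ d] conjI d allI impI)
    fix s assume "dist s t < d"
    from r(2)[OF small[OF this]] show "torus_proj (x + s *\<^sub>R p) \<in> cdom torus a"
      by (simp only: eq[of s])
  qed
  have "((\<lambda>s. cmap torus a (torus_proj (x + t *\<^sub>R p)) + (s - t) *\<^sub>R p) has_derivative (\<lambda>h. h *\<^sub>R p)) (at t)"
    by (auto intro!: derivative_eq_intros)
  then show "((\<lambda>s. cmap torus a (torus_proj (x + s *\<^sub>R p))) has_derivative (\<lambda>h. h *\<^sub>R p)) (at t)"
  proof (rule has_derivative_transform_within[OF _ d])
    fix s assume "dist s t < d"
    from r(3)[OF small[OF this]] show "cmap torus a (torus_proj (x + t *\<^sub>R p)) + (s - t) *\<^sub>R p =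
        cmap torus a (torus_proj (x + s *\<^sub>R p))"
      by (simp only: eq[of s])
  qed simp
qed

lemma line_closed_geodesic:
  assumes p: "p \<noteq> 0" and T: "T \<noteq> 0" "T *\<^sub>R p \<in> \<int> \<times> \<int>"
  shows "closed_geodesic torus flat_metric (\<lambda>t. torus_proj (x + t *\<^sub>R p))"
proof -
  define \<gamma> where "\<gamma> = (\<lambda>t. torus_proj (x + t *\<^sub>R p))"
  have cinv_euclid: "cinv euclid () = (\<lambda>t::real. t)"
  proof
    fix t :: real
    show "cinv euclid () t = t"
      unfolding cinv_def by (rule inv_into_f_eq) (auto simp: euclid_def)
  qed
  have deriv: "((cmap torus a \<circ> \<gamma> \<circ> cinv euclid ()) has_derivative (\<lambda>h. h *\<^sub>R p)) (at t)"
    if "\<gamma> t \<in> cdom torus a" for a t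
    using line_has_derivative_in_chart(1)[of x t p a] that by (simp add: \<gamma>_def comp_def cinv_euclid)
  have ev: "eventually (\<lambda>s. \<gamma> s \<in> cdom torus a) (nhds t)" if "\<gamma> t \<in> cdom torus a" for a t
    using line_has_derivative_in_chart(2) that by (simp add: \<gamma>_def)
  have op: "open (\<gamma> -` cdom torus a)" for a
  proof (subst open_subopen, intro ballI)
    fix t assume "t \<in> \<gamma> -` cdom torus a"
    then show "\<exists>T. open T \<and> t \<in> T \<and> T \<subseteq> \<gamma> -` cdom torus a"
      using ev[of t a] unfolding eventually_nhds by blast
  qed
  have velocity: "velocity torus \<gamma> a t = p" if "\<gamma> t \<in> cdom torus a" for a t
    using frechet_derivative_at[OF deriv[OF that], symmetric]
    by (simp add: velocity_def dmap_def euclid_def)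
  have "smooth_map euclid torus \<gamma>"
    unfolding smooth_map_def
  proof (intro conjI ballI)
    show "\<gamma> ` points euclid \<subseteq> points torus"
      by (auto simp: \<gamma>_def points_torus)
    fix i :: unit and a :: "real \<times> real"
    have eq: "cmap euclid i ` (cdom euclid i \<inter> \<gamma> -` cdom torus a) = \<gamma> -` cdom torus a"
      by (auto simp: euclid_def)
    show "open (cmap euclid i ` (cdom euclid i \<inter> \<gamma> -` cdom torus a))"
      unfolding eq by (rule op)
    show "smooth_on (cmap euclid i ` (cdom euclid i \<inter> \<gamma> -` cdom torus a)) (cmap torus a \<circ> \<gamma> \<circ> cinv euclid i)"
      unfolding eq smooth_on_def
      by (intro allI C_on_if_constant_derivative[where L = "\<lambda>h. h *\<^sub>R p"] op) (use deriv in auto)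
  qed
  moreover have "((\<lambda>s. flat_metric a (\<gamma> s) (velocity torus \<gamma> a s) w) has_real_derivative
      frechet_derivative (\<lambda>x. flat_metric a (cinv torus a x) (velocity torus \<gamma> a t) (velocity torus \<gamma> a t))
        (at (cmap torus a (\<gamma> t))) w / 2) (at t)"
    if "t \<in> \<gamma> -` cdom torus a" for a t w
  proof -
    have "((\<lambda>s. p \<bullet> w) has_real_derivative 0) (at t)" by simp
    then have "((\<lambda>s. velocity torus \<gamma> a s \<bullet> w) has_real_derivative 0) (at t)"
      by (rule has_field_derivative_transform_within_open[OF _ op that]) (simp add: velocity)
    then show ?thesis by (simp add: flat_metric_def)
  qed
  ultimately have "geodesic torus flat_metric \<gamma>"
    unfolding geodesic_def by blast
  moreover have "\<exists>s t. \<gamma> s \<noteq> \<gamma> t"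
  proof -
    define s where "s = 1 / (2 * norm p)"
    have "norm (s *\<^sub>R p) < 1" "s *\<^sub>R p \<noteq> 0" using p by (simp_all add: s_def)
    then have "\<gamma> s \<noteq> \<gamma> 0"
      using Ints_Times_Ints_norm_less_1[of "s *\<^sub>R p"] by (auto simp: \<gamma>_def torus_proj_eq_iff)
    then show ?thesis by blast
  qed
  moreover have "\<gamma> (t + \<bar>T\<bar>) = \<gamma> t" for t
    using T(2) Ints_Times_Ints_minus[OF T(2)]
    by (auto simp: \<gamma>_def torus_proj_eq_iff abs_if algebra_simps)
  ultimately show ?thesis
    using T(1) unfolding closed_geodesic_def \<gamma>_def[symmetric] by (metis zero_less_abs_iff)
qed

section \<open>Leaves of the canonical distribution\<close>

context affine_torus_map
begin

text \<open>The covering of the leaf of the canonical distribution through \<open>(x, p, 0)\<close> by the plane with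
  coordinates along \<open>p\<close> and along the suspension direction \<open>\<theta>\<close>.\<close>

definition leaf :: "real \<times> real \<Rightarrow> real \<times> real \<Rightarrow> real \<times> real \<Rightarrow>
    ((torus_point \<times> (real \<times> real)) \<times> real) set" where
  "leaf x p t = mt_point (x + fst t *\<^sub>R p) p (snd t)"

definition periods :: "real \<times> real \<Rightarrow> real \<times> real \<Rightarrow> (real \<times> real) set" where
  "periods x p = {v. leaf x p v = leaf x p 0}"

lemma linear_A_funpow: "linear (A ^^ n)"
proof (induction n)
  case (Suc n)
  from linear_compose[OF this linear_A] show ?case by (simp add: comp_def)
qed (simp add: linear_iff)

lemma affine_funpow_add: "((\<lambda>x. b + A x) ^^ n) (x + v) = ((\<lambda>x. b + A x) ^^ n) x + (A ^^ n) v"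
  by (induction n) (auto simp: linear_add[OF linear_A])

lemma mt_point_eq_iff:
  assumes "norm p = 1" "norm p' = 1"
  shows "mt_point x p s = mt_point x' p' t \<longleftrightarrow> (\<exists>m n.
    torus_proj (((\<lambda>x. b + A x) ^^ m) x) = torus_proj (((\<lambda>x. b + A x) ^^ n) x') \<and>
    (A ^^ m) p = (A ^^ n) p' \<and> s + real m = t + real n)"
  unfolding mt_point_def using assms
  by (simp add: self.mt_proj_eq_iff mem_points_unit_cotangent funpow_lift conj_assoc)

text \<open>The identifications of the mapping torus are affine in \<open>x\<close> with the linear part that also acts on \<open>p\<close>, so
  they act on leaf coordinates by translations.\<close>

lemma leaf_shift:
  assumes p: "norm p = 1" "norm p' = 1" and eq: "leaf x p s = leaf x' p' t"
  shows "leaf x p (s + v) = leaf x' p' (t + v)"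
proof -
  define \<Phi> where "\<Phi> = (\<lambda>x. b + A x)"
  obtain m n where mn: "torus_proj ((\<Phi> ^^ m) (x + fst s *\<^sub>R p)) = torus_proj ((\<Phi> ^^ n) (x' + fst t *\<^sub>R p'))"
      "(A ^^ m) p = (A ^^ n) p'" "snd s + real m = snd t + real n"
    using eq unfolding leaf_def mt_point_eq_iff[OF p] \<Phi>_def by blast
  have split: "(\<Phi> ^^ k) (y + fst (r + v) *\<^sub>R q) = (\<Phi> ^^ k) (y + fst r *\<^sub>R q) + fst v *\<^sub>R (A ^^ k) q" for k y r q
  proof -
    have "y + fst (r + v) *\<^sub>R q = (y + fst r *\<^sub>R q) + fst v *\<^sub>R q" by (simp add: algebra_simps)
    then show ?thesis
      unfolding \<Phi>_def affine_funpow_add[of _ "y + fst r *\<^sub>R q"]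
      by (simp only: affine_funpow_add linear_scale[OF linear_A_funpow])
  qed
  have "torus_proj ((\<Phi> ^^ m) (x + fst (s + v) *\<^sub>R p)) = torus_proj ((\<Phi> ^^ n) (x' + fst (t + v) *\<^sub>R p'))"
    using mn(1,2) by (simp only: split torus_proj_add)
  moreover have "snd (s + v) + real m = snd (t + v) + real n" using mn(3) by simp
  ultimately show ?thesis
    using mn(2) unfolding leaf_def mt_point_eq_iff[OF p] \<Phi>_def by blast
qed

lemma leaf_eq_iff:
  assumes "norm p = 1"
  shows "leaf x p s = leaf x p t \<longleftrightarrow> s - t \<in> periods x p"
  using leaf_shift[OF assms assms, of x s x t "- t"] leaf_shift[OF assms assms, of x "s - t" x 0 t]
  by (auto simp: periods_def)

lemma periods_diff:
  assumes "norm p = 1" "v \<in> periods x p" "w \<in> periods x p"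
  shows "v - w \<in> periods x p"
  using assms leaf_eq_iff[OF assms(1), of x v w] by (simp add: periods_def)

lemma zero_in_periods: "0 \<in> periods x p"
  by (simp add: periods_def)

lemma periods_uminus:
  assumes "norm p = 1" "v \<in> periods x p"
  shows "- v \<in> periods x p"
  using periods_diff[OF assms(1) zero_in_periods assms(2)] by simp

lemma periods_scale_int:
  assumes "norm p = 1" "v \<in> periods x p" "c \<in> \<int>"
  shows "c *\<^sub>R v \<in> periods x p"
proof -
  have nat: "real n *\<^sub>R v \<in> periods x p" for n
  proof (induction n)
    case (Suc n)
    from periods_diff[OF assms(1) this periods_uminus[OF assms(1,2)]] show ?case
      by (simp add: algebra_simps)
  qed (simp add: zero_in_periods)
  obtain k :: int where k: "c = of_int k" using assms(3) by (auto elim: Ints_cases)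
  show ?thesis
  proof (cases "k \<ge> 0")
    case True
    then show ?thesis using nat[of "nat k"] k by simp
  next
    case False
    then show ?thesis using periods_uminus[OF assms(1) nat[of "nat (- k)"]] k by simp
  qed
qed

lemma periods_snd_Ints:
  assumes "norm p = 1" "v \<in> periods x p"
  shows "snd v \<in> \<int>"
proof -
  obtain m n :: nat where "snd v + real m = 0 + real n"
    using assms(2) unfolding periods_def leaf_def mem_Collect_eq mt_point_eq_iff[OF assms(1,1)] by auto
  then have "snd v = real n - real m" by simp
  then show ?thesis by (metis Ints_diff Ints_of_nat)
qed

text \<open>A period of height \<open>k\<close> is a translation of the base line of the leaf that the \<open>k\<close>-th iterate of
  the isometry induces.\<close>

lemma periods_iterate:
  assumes p: "norm p = 1" and v: "v \<in> periods x p" "snd v = real k"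
  shows "(\<phi> ^^ k) (torus_proj (x + t *\<^sub>R p)) = torus_proj (x + (t + fst v) *\<^sub>R p)"
proof -
  have "leaf x p (t, 0) = leaf x p (v + (t, 0))"
    using leaf_shift[OF p p, of x v x 0 "(t, 0)"] v by (simp add: periods_def)
  then have "((cotangent_lift \<phi>) ^^ k) (torus_proj (x + t *\<^sub>R p), p) = (torus_proj (x + (fst v + t) *\<^sub>R p), p)"
    using p v(2) self.mt_proj_shift_eq_iff[of "(torus_proj (x + t *\<^sub>R p), p)" "(torus_proj (x + (fst v + t) *\<^sub>R p), p)" 0 k]
    by (simp add: leaf_def mt_point_def mem_points_unit_cotangent)
  then have "torus_proj (((\<lambda>x. b + A x) ^^ k) (x + t *\<^sub>R p)) = torus_proj (x + (t + fst v) *\<^sub>R p)"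
    by (simp add: funpow_lift add.commute)
  moreover have "(\<phi> ^^ k) (torus_proj y) = torus_proj (((\<lambda>x. b + A x) ^^ k) y)" for y
    by (induction k) (auto simp: lift)
  ultimately show ?thesis by simp
qed

lemma periods_horizontal:
  assumes p: "norm p = 1" and v: "v \<in> periods x p" "snd v = 0"
  shows "fst v *\<^sub>R p \<in> \<int> \<times> \<int>"
proof -
  have "x + 0 *\<^sub>R p - (x + (0 + fst v) *\<^sub>R p) \<in> \<int> \<times> \<int>"
    using periods_iterate[OF p v(1), of 0 0] v(2) unfolding torus_proj_eq_iff[symmetric] by simp
  from Ints_Times_Ints_minus[OF this] show ?thesis by (simp add: algebra_simps)
qed

lemma periods_norm_less_1:
  assumes p: "norm p = 1" and v: "v \<in> periods x p" "norm v < 1"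
  shows "v = 0"
proof -
  have "\<bar>fst v\<bar> < 1" "\<bar>snd v\<bar> < 1"
    using norm_fst_le[of "fst v" "snd v"] norm_snd_le[of "snd v" "fst v"] v(2) by auto
  then have "snd v = 0"
    using periods_snd_Ints[OF p v(1)] Ints_abs_less_1 by blast
  moreover from periods_horizontal[OF p v(1) this] have "fst v *\<^sub>R p = 0"
    using p \<open>\<bar>fst v\<bar> < 1\<close> by (intro Ints_Times_Ints_norm_less_1) auto
  then have "fst v = 0" using p by (metis norm_zero scaleR_eq_0_iff zero_neq_one)
  ultimately show ?thesis by (simp add: prod_eq_iff)
qed

text \<open>Two independent periods would combine to a nonzero horizontal one, which closes the base line
  up to a closed geodesic, while one of the two has nonzero height, so that an iterate of
  the isometry translates this geodesic along itself.\<close>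

lemma periods_parallel:
  assumes no_fixed: "\<And>\<gamma> k. closed_geodesic torus flat_metric \<gamma> \<Longrightarrow> k \<ge> 1 \<Longrightarrow> (\<phi> ^^ k) ` range \<gamma> \<noteq> range \<gamma>"
    and p: "norm p = 1" and v: "v \<in> periods x p" and w: "w \<in> periods x p"
  shows "fst v * snd w = snd v * fst w"
proof (rule ccontr)
  assume neq: "fst v * snd w \<noteq> snd v * fst w"
  define T where "T = fst v * snd w - snd v * fst w"
  have T: "T \<noteq> 0" using neq by (simp add: T_def)
  have "snd w *\<^sub>R v - snd v *\<^sub>R w \<in> periods x p"
    using periods_diff periods_scale_int periods_snd_Ints p v w by blast
  then have "fst (snd w *\<^sub>R v - snd v *\<^sub>R w) *\<^sub>R p \<in> \<int> \<times> \<int>"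
    by (rule periods_horizontal[OF p]) simp
  moreover have "fst (snd w *\<^sub>R v - snd v *\<^sub>R w) = T" by (simp add: T_def)
  ultimately have "T *\<^sub>R p \<in> \<int> \<times> \<int>" by metis
  with T p have geod: "closed_geodesic torus flat_metric (\<lambda>t. torus_proj (x + t *\<^sub>R p))"
    by (intro line_closed_geodesic[of p T x]) auto
  have "\<exists>u\<in>periods x p. snd u > 0"
  proof -
    have "snd v \<noteq> 0 \<or> snd w \<noteq> 0" using neq by auto
    then have "snd v > 0 \<or> snd (- v) > 0 \<or> snd w > 0 \<or> snd (- w) > 0" by auto
    then show ?thesis using v w periods_uminus[OF p] by blast
  qed
  then obtain u where u: "u \<in> periods x p" "snd u > 0" by blast
  then obtain k :: int where k: "snd u = of_int k"
    using periods_snd_Ints[OF p u(1)] by (auto elim: Ints_cases)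
  then have k': "snd u = real (nat k)" "nat k \<ge> 1" using u by auto
  have "(\<phi> ^^ nat k) ` range (\<lambda>t. torus_proj (x + t *\<^sub>R p)) = range (\<lambda>t. torus_proj (x + (t + fst u) *\<^sub>R p))"
    using periods_iterate[OF p u(1) k'(1)] by (auto simp: image_image)
  also have "\<dots> = range (\<lambda>t. torus_proj (x + t *\<^sub>R p))"
  proof (intro equalityI subsetI)
    fix y assume "y \<in> range (\<lambda>t. torus_proj (x + t *\<^sub>R p))"
    then obtain t where "y = torus_proj (x + t *\<^sub>R p)" by auto
    then have "y = torus_proj (x + ((t - fst u) + fst u) *\<^sub>R p)" by simp
    then show "y \<in> range (\<lambda>t. torus_proj (x + (t + fst u) *\<^sub>R p))" by (rule range_eqI)
  qed auto
  finally show False using no_fixed[OF geod k'(2)] by blast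
qed

end

section \<open>Reeb curves in leaf coordinates\<close>

lemma C_on_subset: "C_on k S f \<Longrightarrow> T \<subseteq> S \<Longrightarrow> C_on k T f"
  by (induction k arbitrary: f) (auto intro: continuous_on_subset)

lemma C_on_cong:
  assumes "open S" "C_on k S f" "\<And>x. x \<in> S \<Longrightarrow> f x = g x"
  shows "C_on k S g"
  using assms(2,3)
proof (induction k arbitrary: f g)
  case 0
  then show ?case using continuous_on_cong[of S S f g] by simp
next
  case (Suc k)
  have diff: "f differentiable (at x)" if "x \<in> S" for x using Suc.prems(1) that by simp
  have eq: "frechet_derivative f (at x) = frechet_derivative g (at x)" if "x \<in> S" for x
    using diff[OF that] \<open>open S\<close> that Suc.prems(2) by (rule frechet_derivative_transform_within_open)
  have "C_on k S (\<lambda>x. frechet_derivative g (at x) v)" for v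
    by (rule Suc.IH[of "\<lambda>x. frechet_derivative f (at x) v"]) (use Suc.prems(1) eq in auto)
  moreover have "g differentiable (at x)" if "x \<in> S" for x
  proof -
    obtain D where "(f has_derivative D) (at x)" using diff[OF \<open>x \<in> S\<close>] by (auto simp: differentiable_def)
    then have "(g has_derivative D) (at x)"
      by (rule has_derivative_transform_within_open[OF _ \<open>open S\<close> that]) (rule Suc.prems(2))
    then show ?thesis by (auto simp: differentiable_def)
  qed
  ultimately show ?case by simp
qed

lemma C_on_bounded_linear:
  assumes B: "bounded_linear B" and S: "open S" and f: "C_on k S f"
  shows "C_on k S (\<lambda>x. B (f x))"
  using f
proof (induction k arbitrary: f)
  case 0
  then show ?case
    using bounded_linear.continuous_on[OF B] by simp
next
  case (Suc k)
  have deriv: "((\<lambda>x. B (f x)) has_derivative (\<lambda>v. B (frechet_derivative f (at x) v))) (at x)" if "x \<in> S" for x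
  proof (rule bounded_linear.has_derivative[OF B])
    show "(f has_derivative frechet_derivative f (at x)) (at x)"
      using Suc.prems that by (simp flip: frechet_derivative_works)
  qed
  have "C_on k S (\<lambda>x. frechet_derivative (\<lambda>x. B (f x)) (at x) v)" for v
  proof (rule C_on_cong[OF S])
    show "C_on k S (\<lambda>x. B (frechet_derivative f (at x) v))"
      using Suc.prems by (intro Suc.IH) simp
    show "B (frechet_derivative f (at x) v) = frechet_derivative (\<lambda>x. B (f x)) (at x) v" if "x \<in> S" for x
      using frechet_derivative_at[OF deriv[OF that]] by metis
  qed
  then show ?case using deriv by (auto simp: differentiable_def)
qed

lemma smooth_on_differentiable: "smooth_on S f \<Longrightarrow> x \<in> S \<Longrightarrow> f differentiable (at x)"
  using C_on.simps(2)[of 0] unfolding smooth_on_def by blast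

lemma constant_on_ball_if_derivative_zero:
  fixes f :: "'a::real_normed_vector \<Rightarrow> 'b::real_inner"
  assumes "\<And>y. y \<in> ball x r \<Longrightarrow> (f has_derivative (\<lambda>_. 0)) (at y)" "y \<in> ball x r"
  shows "f y = f x"
proof -
  have "x \<in> ball x r" using assms(2) by (auto intro: le_less_trans[OF zero_le_dist])
  then show ?thesis
    using has_derivative_zero_constant[OF convex_ball, of x r f] assms
    by (metis has_derivative_at_withinI)
qed

context affine_torus_map
begin

text \<open>Tangency to the canonical distribution means that, in a chart, \<open>ds = 0\<close> and \<open>dx\<close> is a multiple of
  \<open>p = (cos s, sin s)\<close>. So \<open>s\<close>, and then the component of \<open>x\<close> normal to \<open>p\<close>, are locally constant, and the
  curve stays in one leaf. Its derivative has rank 0 or 2 in the leaf coordinates.\<close>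

lemma local_leaf_coordinates:
  fixes S :: "('s, 'i, complex) manifold" and w :: "'s \<Rightarrow> ((torus_point \<times> (real \<times> real)) \<times> real) set"
  assumes smooth: "smooth_map S M w"
    and tangent: "\<And>z. z \<in> cdom S i \<Longrightarrow> w z \<in> cdom M j \<Longrightarrow> dmap S M w i j z \<noteq> (\<lambda>_. 0) \<Longrightarrow>
        range (dmap S M w i j z) = canonical_distribution M (mt_form liouville) mt_dtheta j (w z)"
    and inj: "inj_on (cmap S i) (cdom S i)"
    and i: "i \<in> idx S" and z: "z \<in> cdom S i" "w z \<in> cdom M j"
  obtains r x p t where "r > 0" "ball (cmap S i z) r \<subseteq> cmap S i ` cdom S i" "norm p = 1"
    "smooth_on (ball (cmap S i z) r) t"
    "\<And>\<zeta>. \<zeta> \<in> ball (cmap S i z) r \<Longrightarrow> w (cinv S i \<zeta>) = leaf x p (t \<zeta>)"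
    "\<And>\<zeta>. \<zeta> \<in> ball (cmap S i z) r \<Longrightarrow>
       frechet_derivative t (at \<zeta>) = (\<lambda>_. 0) \<or> surj (frechet_derivative t (at \<zeta>))"
    "frechet_derivative t (at (cmap S i z)) = (\<lambda>_. 0) \<Longrightarrow> dmap S M w i j z = (\<lambda>_. 0)"
proof -
  define U where "U = cmap S i ` (cdom S i \<inter> w -` cdom M j)"
  define g where "g = cmap M j \<circ> w \<circ> cinv S i"
  have U: "open U" "smooth_on U g"
    using smooth i idx_M unfolding smooth_map_def U_def g_def by blast+
  define \<zeta>\<^sub>0 where "\<zeta>\<^sub>0 = cmap S i z"
  have "\<zeta>\<^sub>0 \<in> U" using z by (auto simp: U_def \<zeta>\<^sub>0_def)
  then obtain r where r: "r > 0" "ball \<zeta>\<^sub>0 r \<subseteq> U"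
    using U(1) openE by blast
  have centre: "\<zeta>\<^sub>0 \<in> ball \<zeta>\<^sub>0 r" using r by simp
  define G' where "G' = (\<lambda>\<zeta>. frechet_derivative g (at \<zeta>))"
  have dg: "(g has_derivative G' \<zeta>) (at \<zeta>)" if "\<zeta> \<in> U" for \<zeta>
    using smooth_on_differentiable[OF U(2) that] frechet_derivative_works unfolding G'_def by blast
  have point: "cinv S i \<zeta> \<in> cdom S i" "cmap S i (cinv S i \<zeta>) = \<zeta>" "w (cinv S i \<zeta>) \<in> cdom M j"
    "g \<zeta> = cmap M j (w (cinv S i \<zeta>))" "dmap S M w i j (cinv S i \<zeta>) = G' \<zeta>" if \<zeta>: "\<zeta> \<in> U" for \<zeta>
  proof -
    obtain y where y: "y \<in> cdom S i" "w y \<in> cdom M j" "\<zeta> = cmap S i y"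
      using \<zeta> by (auto simp: U_def)
    have "cinv S i \<zeta> = y" using y inj by (simp add: cinv_def)
    then show "cinv S i \<zeta> \<in> cdom S i" "cmap S i (cinv S i \<zeta>) = \<zeta>" "w (cinv S i \<zeta>) \<in> cdom M j"
      "g \<zeta> = cmap M j (w (cinv S i \<zeta>))" "dmap S M w i j (cinv S i \<zeta>) = G' \<zeta>"
      using y by (simp_all add: g_def G'_def dmap_def)
  qed
  define s where "s = (\<lambda>\<zeta>. snd (fst (g \<zeta>)))"
  have distr: "v \<in> canonical_distribution M (mt_form liouville) mt_dtheta j (w (cinv S i \<zeta>)) \<longleftrightarrow>
      (\<exists>a c. v = ((a *\<^sub>R (cos (s \<zeta>), sin (s \<zeta>)), 0), c))" if "\<zeta> \<in> U" for \<zeta> v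
    by (rule mem_canonical_distribution_M) (use point[OF that] in \<open>simp_all add: s_def\<close>)
  have G': "\<exists>a c. G' \<zeta> v = ((a *\<^sub>R (cos (s \<zeta>), sin (s \<zeta>)), 0), c)" if "\<zeta> \<in> U" for \<zeta> v
  proof (cases "G' \<zeta> = (\<lambda>_. 0)")
    case True
    then show ?thesis by (intro exI[of _ 0]) (simp add: zero_prod_def)
  next
    case False
    then have "G' \<zeta> v \<in> canonical_distribution M (mt_form liouville) mt_dtheta j (w (cinv S i \<zeta>))"
      using tangent[OF point(1,3)[OF that]] point(5)[OF that] by auto
    then show ?thesis using distr[OF that] by blast
  qed
  have ds: "(s has_derivative (\<lambda>_. 0)) (at \<zeta>)" if "\<zeta> \<in> U" for \<zeta>
  proof -
    have "(s has_derivative (\<lambda>v. snd (fst (G' \<zeta> v)))) (at \<zeta>)"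
      unfolding s_def by (intro has_derivative_snd has_derivative_fst dg[OF that])
    moreover have "(\<lambda>v. snd (fst (G' \<zeta> v))) = (\<lambda>_. 0)"
    proof
      fix v show "snd (fst (G' \<zeta> v)) = 0" using G'[OF that, of v] by auto
    qed
    ultimately show ?thesis by simp
  qed
  define \<sigma> where "\<sigma> = s \<zeta>\<^sub>0"
  have s: "s \<zeta> = \<sigma>" if "\<zeta> \<in> ball \<zeta>\<^sub>0 r" for \<zeta>
    unfolding \<sigma>_def using ds r(2) that by (intro constant_on_ball_if_derivative_zero) auto
  define p where "p = (cos \<sigma>, sin \<sigma>)"
  define n where "n = (- sin \<sigma>, cos \<sigma>)"
  have p: "norm p = 1" by (simp add: p_def norm_Pair)
  have pp: "p \<bullet> p = 1" "n \<bullet> p = 0" using p by (simp_all add: dot_square_norm) (simp add: n_def p_def)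
  have dx: "((\<lambda>\<zeta>. n \<bullet> fst (fst (g \<zeta>))) has_derivative (\<lambda>_. 0)) (at \<zeta>)" if "\<zeta> \<in> ball \<zeta>\<^sub>0 r" for \<zeta>
  proof -
    have \<zeta>U: "\<zeta> \<in> U" using that r by blast
    have "((\<lambda>\<zeta>. n \<bullet> fst (fst (g \<zeta>))) has_derivative (\<lambda>v. n \<bullet> fst (fst (G' \<zeta> v)))) (at \<zeta>)"
      by (intro has_derivative_inner_right has_derivative_fst dg[OF \<zeta>U])
    moreover have "(\<lambda>v. n \<bullet> fst (fst (G' \<zeta> v))) = (\<lambda>_. 0)"
    proof
      fix v show "n \<bullet> fst (fst (G' \<zeta> v)) = 0"
        using G'[OF \<zeta>U, of v] s[OF that] pp(2) by (auto simp: p_def[symmetric])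
    qed
    ultimately show ?thesis by simp
  qed
  define c where "c = n \<bullet> fst (fst (g \<zeta>\<^sub>0))"
  have c: "n \<bullet> fst (fst (g \<zeta>)) = c" if "\<zeta> \<in> ball \<zeta>\<^sub>0 r" for \<zeta>
    unfolding c_def using constant_on_ball_if_derivative_zero[of \<zeta>\<^sub>0 r "\<lambda>\<zeta>. n \<bullet> fst (fst (g \<zeta>))", OF dx that] by simp
  have decomp: "y = (y \<bullet> p) *\<^sub>R p + (n \<bullet> y) *\<^sub>R n" for y
  proof -
    obtain a b where y: "y = (a, b)" by (metis prod.collapse)
    have "a = (a * cos \<sigma> + b * sin \<sigma>) * cos \<sigma> + (- sin \<sigma> * a + cos \<sigma> * b) * (- sin \<sigma>)"
      "b = (a * cos \<sigma> + b * sin \<sigma>) * sin \<sigma> + (- sin \<sigma> * a + cos \<sigma> * b) * cos \<sigma>"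
      using sin_cos_squared_add3[of \<sigma>] by algebra+
    then show ?thesis by (simp add: y p_def n_def)
  qed
  define B where "B = (\<lambda>\<xi> :: ((real \<times> real) \<times> real) \<times> real. (fst (fst \<xi>) \<bullet> p, snd \<xi>))"
  have B: "bounded_linear B"
    unfolding B_def
    by (intro bounded_linear_Pair bounded_linear_inner_left[THEN bounded_linear_compose]
        bounded_linear_fst_comp bounded_linear_fst bounded_linear_snd)
  define t where "t = (\<lambda>\<zeta>. B (g \<zeta>))"
  have dt: "frechet_derivative t (at \<zeta>) = (\<lambda>v. B (G' \<zeta> v))" if "\<zeta> \<in> U" for \<zeta>
    unfolding t_def
    by (rule frechet_derivative_at[OF bounded_linear.has_derivative[OF B dg[OF that]], symmetric])
  \<comment> \<open>The base point \<open>c n\<close> is the foot of the perpendicular from the origin to the line in which \<open>x\<close> moves.\<close>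
  show thesis
  proof (rule that[of r p t "c *\<^sub>R n", folded \<zeta>\<^sub>0_def])
    show "r > 0" "norm p = 1" by fact+
    show "ball \<zeta>\<^sub>0 r \<subseteq> cmap S i ` cdom S i" using r(2) by (auto simp: U_def)
    show "smooth_on (ball \<zeta>\<^sub>0 r) t"
      unfolding smooth_on_def t_def
    proof
      fix k
      have "C_on k (ball \<zeta>\<^sub>0 r) g"
        using U(2) r(2) unfolding smooth_on_def by (blast intro: C_on_subset)
      then show "C_on k (ball \<zeta>\<^sub>0 r) (\<lambda>\<zeta>. B (g \<zeta>))"
        by (rule C_on_bounded_linear[OF B open_ball])
    qed
    fix \<zeta> assume \<zeta>: "\<zeta> \<in> ball \<zeta>\<^sub>0 r"
    then have \<zeta>U: "\<zeta> \<in> U" using r by blast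
    have "w (cinv S i \<zeta>) = chart_point (g \<zeta>)"
      using chart_point_cmap[OF point(3)[OF \<zeta>U]] point(4)[OF \<zeta>U] by simp
    also have "\<dots> = mt_point (fst (fst (g \<zeta>))) p (snd (g \<zeta>))"
      using s[OF \<zeta>] by (simp add: chart_point_def s_def p_def)
    also have "fst (fst (g \<zeta>)) = c *\<^sub>R n + fst (t \<zeta>) *\<^sub>R p"
      using decomp[of "fst (fst (g \<zeta>))"] c[OF \<zeta>] by (simp add: t_def B_def add.commute)
    also have "snd (g \<zeta>) = snd (t \<zeta>)" by (simp add: t_def B_def)
    finally show "w (cinv S i \<zeta>) = leaf (c *\<^sub>R n) p (t \<zeta>)" by (simp add: leaf_def)
    show "frechet_derivative t (at \<zeta>) = (\<lambda>_. 0) \<or> surj (frechet_derivative t (at \<zeta>))"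
    proof (cases "G' \<zeta> = (\<lambda>_. 0)")
      case True
      then have "frechet_derivative t (at \<zeta>) = (\<lambda>v. B 0)" using dt[OF \<zeta>U] by simp
      then show ?thesis using linear_0[OF bounded_linear.linear[OF B]] by simp
    next
      case False
      have "\<exists>v. frechet_derivative t (at \<zeta>) v = y" for y
      proof -
        have "((fst y *\<^sub>R p, 0), snd y) \<in> range (G' \<zeta>)"
          using tangent[OF point(1,3)[OF \<zeta>U]] point(5)[OF \<zeta>U] False distr[OF \<zeta>U] s[OF \<zeta>]
          by (auto simp: p_def)
        then obtain v where "G' \<zeta> v = ((fst y *\<^sub>R p, 0), snd y)" by (metis rangeE)
        then have "frechet_derivative t (at \<zeta>) v = y" using pp(1) by (simp add: dt[OF \<zeta>U] B_def)
        then show ?thesis by blast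
      qed
      then show ?thesis by (metis surjI)
    qed
  next
    assume zero: "frechet_derivative t (at \<zeta>\<^sub>0) = (\<lambda>_. 0)"
    have "\<zeta>\<^sub>0 \<in> U" by fact
    have "G' \<zeta>\<^sub>0 v = 0" for v
    proof -
      obtain a b where ab: "G' \<zeta>\<^sub>0 v = ((a *\<^sub>R p, 0), b)"
        using G'[OF \<open>\<zeta>\<^sub>0 \<in> U\<close>, of v] by (auto simp: p_def \<sigma>_def)
      have "B (G' \<zeta>\<^sub>0 v) = 0" using fun_cong[OF zero, of v] dt[OF \<open>\<zeta>\<^sub>0 \<in> U\<close>] by simp
      then have "a = 0" "b = 0" using pp(1) by (simp_all add: B_def ab zero_prod_def)
      then show ?thesis by (simp add: ab zero_prod_def)
    qed
    moreover have "cinv S i \<zeta>\<^sub>0 = z" using z(1) inj by (simp add: cinv_def \<zeta>\<^sub>0_def)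
    ultimately show "dmap S M w i j z = (\<lambda>_. 0)"
      using point(5)[OF \<open>\<zeta>\<^sub>0 \<in> U\<close>] by auto
  qed
qed

end

section \<open>Covering a compact Riemann surface by discs\<close>

lemma openin_manifold_topology:
  assumes inj: "\<forall>i\<in>idx S. inj_on (cmap S i) (cdom S i)"
  shows "openin (manifold_topology S) U \<longleftrightarrow>
    U \<subseteq> points S \<and> (\<forall>i\<in>idx S. open (cmap S i ` (U \<inter> cdom S i)))"
proof -
  have "istopology (\<lambda>U. U \<subseteq> points S \<and> (\<forall>i\<in>idx S. open (cmap S i ` (U \<inter> cdom S i))))"
    unfolding istopology_def
  proof (intro conjI allI impI)
    fix U V assume U: "U \<subseteq> points S \<and> (\<forall>i\<in>idx S. open (cmap S i ` (U \<inter> cdom S i)))"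
      and V: "V \<subseteq> points S \<and> (\<forall>i\<in>idx S. open (cmap S i ` (V \<inter> cdom S i)))"
    then show "U \<inter> V \<subseteq> points S" by blast
    show "\<forall>i\<in>idx S. open (cmap S i ` (U \<inter> V \<inter> cdom S i))"
    proof
      fix i assume i: "i \<in> idx S"
      have "cmap S i ` (U \<inter> V \<inter> cdom S i) = cmap S i ` (U \<inter> cdom S i) \<inter> cmap S i ` (V \<inter> cdom S i)"
        using inj i by (auto simp: inj_on_def)
      then show "open (cmap S i ` (U \<inter> V \<inter> cdom S i))" using U V i by auto
    qed
  next
    fix \<U> assume *: "\<forall>U\<in>\<U>. U \<subseteq> points S \<and> (\<forall>i\<in>idx S. open (cmap S i ` (U \<inter> cdom S i)))"
    then show "\<Union>\<U> \<subseteq> points S" by blast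
    show "\<forall>i\<in>idx S. open (cmap S i ` (\<Union>\<U> \<inter> cdom S i))"
    proof
      fix i assume i: "i \<in> idx S"
      have "cmap S i ` (\<Union>\<U> \<inter> cdom S i) = (\<Union>U\<in>\<U>. cmap S i ` (U \<inter> cdom S i))" by blast
      then show "open (cmap S i ` (\<Union>\<U> \<inter> cdom S i))" using * i by auto
    qed
  qed
  then show ?thesis by (simp add: manifold_topology_def topology_inverse')
qed

lemma openin_chart_preimage:
  assumes S: "riemann_surface S" and i: "i \<in> idx S" and B: "open B" "B \<subseteq> cmap S i ` cdom S i"
  shows "openin (manifold_topology S) (cinv S i ` B)"
proof -
  have inj: "\<forall>i\<in>idx S. inj_on (cmap S i) (cdom S i)"
    using S by (simp add: riemann_surface_def)
  have cinv: "cinv S k (cmap S k q) = q" if "k \<in> idx S" "q \<in> cdom S k" for k q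
    using inj that by (simp add: cinv_def)
  have inB: "q \<in> cinv S i ` B \<longleftrightarrow> q \<in> cdom S i \<and> cmap S i q \<in> B" for q
    using B(2) cinv[OF i] by (force simp: image_iff)
  show ?thesis
    unfolding openin_manifold_topology[OF inj]
  proof (intro conjI ballI)
    show "cinv S i ` B \<subseteq> points S" using inB i by (auto simp: points_def)
    fix j assume j: "j \<in> idx S"
    define V where "V = cmap S j ` (cdom S j \<inter> cdom S i)"
    have V: "open V" "(cmap S i \<circ> cinv S j) holomorphic_on V"
      using S i j unfolding riemann_surface_def V_def by blast+
    have "open (V \<inter> (cmap S i \<circ> cinv S j) -` B)"
      using continuous_open_preimage[OF holomorphic_on_imp_continuous_on[OF V(2)] V(1) B(1)] .
    also have "V \<inter> (cmap S i \<circ> cinv S j) -` B = cmap S j ` (cinv S i ` B \<inter> cdom S j)"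
    proof (intro equalityI subsetI)
      fix \<xi> assume "\<xi> \<in> V \<inter> (cmap S i \<circ> cinv S j) -` B"
      then obtain y where y: "y \<in> cdom S j" "y \<in> cdom S i" "\<xi> = cmap S j y" "cmap S i y \<in> B"
        using cinv[OF j] by (auto simp: V_def)
      then show "\<xi> \<in> cmap S j ` (cinv S i ` B \<inter> cdom S j)" using inB[of y] by blast
    next
      fix \<xi> assume "\<xi> \<in> cmap S j ` (cinv S i ` B \<inter> cdom S j)"
      then obtain y where y: "y \<in> cinv S i ` B" "y \<in> cdom S j" "\<xi> = cmap S j y" by blast
      then show "\<xi> \<in> V \<inter> (cmap S i \<circ> cinv S j) -` B"
        using cinv[OF j] inB[of y] by (auto simp: V_def)
    qed
    finally show "open (cmap S j ` (cinv S i ` B \<inter> cdom S j))" .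
  qed
qed

lemma finite_disc_cover:
  assumes S: "riemann_surface S" and cpt: "compact_space (manifold_topology S)"
    and I: "\<And>z. z \<in> points S \<Longrightarrow> I z \<in> idx S \<and> z \<in> cdom S (I z)"
    and R: "\<And>z. z \<in> points S \<Longrightarrow> R z > 0 \<and> ball (cmap S (I z) z) (R z) \<subseteq> cmap S (I z) ` cdom S (I z)"
  obtains Z where "finite Z" "Z \<subseteq> points S"
    "points S \<subseteq> (\<Union>z\<in>Z. cinv S (I z) ` ball (cmap S (I z) z) (R z))"
proof -
  have inj: "\<forall>i\<in>idx S. inj_on (cmap S i) (cdom S i)"
    using S by (simp add: riemann_surface_def)
  define D where "D = (\<lambda>z. cinv S (I z) ` ball (cmap S (I z) z) (R z))"
  have opD: "openin (manifold_topology S) (D z)" if "z \<in> points S" for z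
    unfolding D_def using I[OF that] R[OF that] by (intro openin_chart_preimage[OF S]) auto
  have inD: "z \<in> D z" if z: "z \<in> points S" for z
  proof -
    have "cinv S (I z) (cmap S (I z) z) = z" using inj I[OF z] by (simp add: cinv_def)
    moreover have "cmap S (I z) z \<in> ball (cmap S (I z) z) (R z)" using R[OF z] by simp
    ultimately show ?thesis unfolding D_def by (metis imageI)
  qed
  have "topspace (manifold_topology S) \<subseteq> points S"
    using openin_manifold_topology[OF inj, of "topspace (manifold_topology S)"] by simp
  then have "topspace (manifold_topology S) \<subseteq> \<Union>(D ` points S)" using inD by blast
  moreover have "\<Union>(D ` points S) \<subseteq> topspace (manifold_topology S)"
    using opD openin_subset by blast
  moreover have "points S \<subseteq> \<Union>(D ` points S)" using inD by blast
  ultimately have top: "points S \<subseteq> topspace (manifold_topology S)" "topspace (manifold_topology S) \<subseteq> \<Union>(D ` points S)"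
    by blast+
  obtain F where F: "finite F" "F \<subseteq> D ` points S" "topspace (manifold_topology S) \<subseteq> \<Union>F"
    using cpt opD top(2) unfolding compact_space_def compactin_def by (metis (no_types, lifting) imageE)
  obtain Z where Z: "Z \<subseteq> points S" "finite Z" "F = D ` Z"
    using finite_subset_image[OF F(1,2)] by blast
  show thesis
    by (rule that[of Z]) (use Z F top(1) in \<open>auto simp: D_def\<close>)
qed

section \<open>Absence of Reeb curves\<close>

lemma surjective_derivative_interior:
  fixes t :: "'a::euclidean_space \<Rightarrow> 'b::euclidean_space"
  assumes U: "open U" "\<zeta> \<in> U" and diff: "\<And>x. x \<in> U \<Longrightarrow> t differentiable (at x)"
    and surj: "surj (frechet_derivative t (at \<zeta>))"
  obtains e where "e > 0" "ball (t \<zeta>) e \<subseteq> t ` U"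
proof -
  have deriv: "(t has_derivative frechet_derivative t (at \<zeta>)) (at \<zeta>)"
    using diff[OF U(2)] frechet_derivative_works by blast
  obtain g' where g': "linear g'" "frechet_derivative t (at \<zeta>) \<circ> g' = id"
    using linear_surjective_right_inverse[OF linear_frechet_derivative[OF diff[OF U(2)]] surj] by blast
  have "continuous_on U t"
    using U(1) diff by (auto intro!: differentiable_imp_continuous_on differentiable_at_imp_differentiable_on)
  then have "t \<zeta> \<in> interior (t ` U)"
    using U g' deriv by (intro sussmann_open_mapping[of U t \<zeta> _ g' U]) (auto simp: linear_linear interior_open)
  then show thesis using that by (auto simp: mem_interior)
qed

context affine_torus_map
begin

text \<open>Suppose that the derivative is nonzero at \<open>z0\<close>, and let \<open>Im\<close> be the set of leaf coordinates
  \<open>t \<in> \<real>\<^sup>2\<close> whose point on the leaf through \<open>w z0\<close> is covered by the curve. It contains a disc, it is closed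
  because the surface is compact, and it is a neighbourhood of each of its regular values. The periods of
  the leaf lie on a line; take \<open>d\<close> normal to it. By Sard's theorem some line in direction \<open>d\<close> meets the
  disc and contains no critical value. The intersection of \<open>Im\<close> with this line is open and closed in it, so
  the whole line is covered. But the component along \<open>d\<close>, which is unbounded on the line, is not changed
  by periods, and compactness bounds it on the curve: this is a contradiction.\<close>

lemma reeb_curve_constant:
  fixes S :: "('s, 'i, complex) manifold" and w :: "'s \<Rightarrow> ((torus_point \<times> (real \<times> real)) \<times> real) set"
  assumes no_fixed: "\<And>\<gamma> k. closed_geodesic torus flat_metric \<gamma> \<Longrightarrow> k \<ge> 1 \<Longrightarrow> (\<phi> ^^ k) ` range \<gamma> \<noteq> range \<gamma>"
    and S: "riemann_surface S" and cpt: "compact_space (manifold_topology S)"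
    and smooth: "smooth_map S M w"
    and tangent: "\<And>i j z. i \<in> idx S \<Longrightarrow> z \<in> cdom S i \<Longrightarrow> w z \<in> cdom M j \<Longrightarrow> dmap S M w i j z \<noteq> (\<lambda>_. 0) \<Longrightarrow>
        range (dmap S M w i j z) = canonical_distribution M (mt_form liouville) mt_dtheta j (w z)"
    and z0: "i0 \<in> idx S" "z0 \<in> cdom S i0" "w z0 \<in> cdom M j0"
  shows "dmap S M w i0 j0 z0 = (\<lambda>_. 0)"
proof (rule ccontr)
  assume nonzero: "dmap S M w i0 j0 z0 \<noteq> (\<lambda>_. 0)"
  have inj: "\<And>i. i \<in> idx S \<Longrightarrow> inj_on (cmap S i) (cdom S i)"
    using S by (simp add: riemann_surface_def)
  have cinv_points: "cinv S i \<zeta> \<in> points S" if "i \<in> idx S" "\<zeta> \<in> cmap S i ` cdom S i" for i \<zeta>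
    using that inj by (auto simp: cinv_def points_def)
  define Q where "Q = (\<lambda>i z r x p t. r > 0 \<and> ball (cmap S i z) r \<subseteq> cmap S i ` cdom S i \<and> norm p = 1 \<and>
    smooth_on (ball (cmap S i z) r) t \<and>
    (\<forall>\<zeta>\<in>ball (cmap S i z) r. w (cinv S i \<zeta>) = leaf x p (t \<zeta>)) \<and>
    (\<forall>\<zeta>\<in>ball (cmap S i z) r. frechet_derivative t (at \<zeta>) = (\<lambda>_. 0) \<or> surj (frechet_derivative t (at \<zeta>))))"
  have local: "\<exists>r x p t. Q i z r x p t \<and> (frechet_derivative t (at (cmap S i z)) = (\<lambda>_. 0) \<longrightarrow> dmap S M w i j z = (\<lambda>_. 0))"
    if i: "i \<in> idx S" and z: "z \<in> cdom S i" "w z \<in> cdom M j" for i j z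
    unfolding Q_def
    by (rule local_leaf_coordinates[OF smooth tangent[OF i] inj[OF i] i z]) blast+
  have "\<exists>i r x p t. i \<in> idx S \<and> z \<in> cdom S i \<and> Q i z r x p t" if "z \<in> points S" for z
  proof -
    obtain i where i: "i \<in> idx S" "z \<in> cdom S i" using \<open>z \<in> points S\<close> by (auto simp: points_def)
    have "w z \<in> points M" using smooth \<open>z \<in> points S\<close> by (auto simp: smooth_map_def)
    then obtain j where "w z \<in> cdom M j" by (auto simp: points_def)
    then obtain r x p t where "Q i z r x p t" using local[OF i] by blast
    then show ?thesis using i by blast
  qed
  then obtain I R X P T where IRXPT: "\<And>z. z \<in> points S \<Longrightarrow>
      I z \<in> idx S \<and> z \<in> cdom S (I z) \<and> Q (I z) z (R z) (X z) (P z) (T z)"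
    by metis
  define c where "c = (\<lambda>z. cmap S (I z) z)"
  have R: "R z > 0" and ballS: "ball (c z) (R z) \<subseteq> cmap S (I z) ` cdom S (I z)"
    and P: "norm (P z) = 1" and smT: "smooth_on (ball (c z) (R z)) (T z)"
    and wT: "\<And>\<zeta>. \<zeta> \<in> ball (c z) (R z) \<Longrightarrow> w (cinv S (I z) \<zeta>) = leaf (X z) (P z) (T z \<zeta>)"
    and rank: "\<And>\<zeta>. \<zeta> \<in> ball (c z) (R z) \<Longrightarrow> frechet_derivative (T z) (at \<zeta>) = (\<lambda>_. 0) \<or> surj (frechet_derivative (T z) (at \<zeta>))"
    and Iz: "I z \<in> idx S" "z \<in> cdom S (I z)"
    if "z \<in> points S" for z
    using IRXPT[OF that] unfolding Q_def c_def by blast+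
  \<comment> \<open>Finitely many concentric discs of half the radius cover, so their closures lie in the domains
    of the leaf coordinates.\<close>
  obtain Z where Z: "finite Z" "Z \<subseteq> points S"
    "points S \<subseteq> (\<Union>z\<in>Z. cinv S (I z) ` ball (cmap S (I z) z) (R z / 2))"
  proof (rule finite_disc_cover[OF S cpt])
    fix z assume z: "z \<in> points S"
    show "I z \<in> idx S \<and> z \<in> cdom S (I z)" using Iz[OF z] by blast
    have "ball (c z) (R z / 2) \<subseteq> ball (c z) (R z)" using R[OF z] by (intro subset_ball) simp
    then show "R z / 2 > 0 \<and> ball (cmap S (I z) z) (R z / 2) \<subseteq> cmap S (I z) ` cdom S (I z)"
      using R[OF z] ballS[OF z] by (auto simp: c_def)
  qed blast
  obtain r0 x0 p0 t0 where Q0: "Q i0 z0 r0 x0 p0 t0"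
    and crit0: "frechet_derivative t0 (at (cmap S i0 z0)) = (\<lambda>_. 0) \<longrightarrow> dmap S M w i0 j0 z0 = (\<lambda>_. 0)"
    using local[OF z0] by blast
  have p0: "norm p0 = 1" using Q0 by (simp add: Q_def)
  define G where "G = (\<lambda>z. {v. leaf x0 p0 v = leaf (X z) (P z) 0})"
  have leaf_G: "leaf (X z) (P z) s = leaf x0 p0 t \<longleftrightarrow> t - s \<in> G z" if z: "z \<in> points S" for z s t
    using leaf_shift[OF P[OF z] p0, of "X z" s x0 t "- s"] leaf_shift[OF p0 P[OF z], of x0 "t - s" "X z" 0 s]
    by (auto simp: G_def)
  have G_diff: "v - v' \<in> periods x0 p0" if "v \<in> G z" "v' \<in> G z" for v v' z
    using that leaf_eq_iff[OF p0, of x0 v v'] by (simp add: G_def)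
  have unifG: "uniform_discrete (G z)" for z
    unfolding uniform_discrete_def
  proof (intro exI[of _ 1] conjI ballI impI)
    fix v v' assume "v \<in> G z" "v' \<in> G z" "dist v v' < 1"
    then show "v = v'" using periods_norm_less_1[OF p0 G_diff] by (simp add: dist_norm)
  qed simp
  have closedG: "closed (G z)" and countableG: "countable (G z)" for z
    using uniform_discrete_imp_closed[OF unifG] sparse_imp_countable[OF open_UNIV uniform_discrete_imp_sparse[OF unifG]]
    by auto
  \<comment> \<open>The part of the leaf through \<open>w z0\<close> that the curve covers.\<close>
  define Im where "Im = {t. \<exists>y\<in>points S. w y = leaf x0 p0 t}"
  have ImI: "t \<in> Im" if z: "z \<in> points S" and \<zeta>: "\<zeta> \<in> ball (c z) (R z)" and "t - T z \<zeta> \<in> G z" for z \<zeta> t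
  proof -
    have "w (cinv S (I z) \<zeta>) = leaf x0 p0 t"
      using wT[OF z \<zeta>] leaf_G[OF z] that(3) by simp
    moreover have "cinv S (I z) \<zeta> \<in> points S" using cinv_points[OF Iz(1)[OF z]] ballS[OF z] \<zeta> by blast
    ultimately show ?thesis unfolding Im_def by blast
  qed
  have ImE: "\<exists>z\<in>Z. \<exists>\<zeta>\<in>cball (c z) (R z / 2). t - T z \<zeta> \<in> G z" if "t \<in> Im" for t
  proof -
    obtain y where y: "y \<in> points S" "w y = leaf x0 p0 t" using \<open>t \<in> Im\<close> by (auto simp: Im_def)
    then obtain z \<zeta> where z: "z \<in> Z" and \<zeta>: "\<zeta> \<in> ball (c z) (R z / 2)" "y = cinv S (I z) \<zeta>"
      using Z(3) unfolding c_def by blast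
    have zS: "z \<in> points S" using z Z(2) by blast
    have "\<zeta> \<in> ball (c z) (R z)" using \<zeta>(1) R[OF zS] by auto
    then have "leaf (X z) (P z) (T z \<zeta>) = leaf x0 p0 t" using wT[OF zS] y \<zeta>(2) by metis
    then have "t - T z \<zeta> \<in> G z" using leaf_G[OF zS] by blast
    moreover have "\<zeta> \<in> cball (c z) (R z / 2)" using \<zeta>(1) by simp
    ultimately show ?thesis using z by blast
  qed
  have half: "cball (c z) (R z / 2) \<subseteq> ball (c z) (R z)" if "z \<in> points S" for z
    using R[OF that] by (simp add: cball_subset_ball_iff)
  have compT: "compact (T z ` cball (c z) (R z / 2))" if z: "z \<in> points S" for z
  proof -
    have "continuous_on (ball (c z) (R z)) (T z)"
      using smT[OF z] unfolding smooth_on_def by (metis C_on.simps(1))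
    then show ?thesis
      using half[OF z] by (intro compact_continuous_image continuous_on_subset[OF _ half[OF z]]) auto
  qed
  have "closed Im"
  proof -
    have "Im = (\<Union>z\<in>Z. {a + b |a b. a \<in> T z ` cball (c z) (R z / 2) \<and> b \<in> G z})"
    proof (intro equalityI subsetI)
      fix t assume "t \<in> Im"
      from ImE[OF this] obtain z \<zeta> where "z \<in> Z" "\<zeta> \<in> cball (c z) (R z / 2)" "t - T z \<zeta> \<in> G z" by blast
      moreover have "t = T z \<zeta> + (t - T z \<zeta>)" by simp
      ultimately show "t \<in> (\<Union>z\<in>Z. {a + b |a b. a \<in> T z ` cball (c z) (R z / 2) \<and> b \<in> G z})" by blast
    next
      fix t assume "t \<in> (\<Union>z\<in>Z. {a + b |a b. a \<in> T z ` cball (c z) (R z / 2) \<and> b \<in> G z})"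
      then obtain z \<zeta> g where *: "z \<in> Z" "\<zeta> \<in> cball (c z) (R z / 2)" "g \<in> G z" "t = T z \<zeta> + g" by blast
      then have "z \<in> points S" using Z(2) by blast
      from ImI[OF this subsetD[OF half[OF this] *(2)]] *(3,4) show "t \<in> Im" by simp
    qed
    moreover have "closed {a + b |a b. a \<in> T z ` cball (c z) (R z / 2) \<and> b \<in> G z}" if "z \<in> Z" for z
    proof -
      have "{a + b |a b. a \<in> T z ` cball (c z) (R z / 2) \<and> b \<in> G z} =
          (\<Union>a\<in>T z ` cball (c z) (R z / 2). \<Union>b\<in>G z. {a + b})" by blast
      then show ?thesis
        using compact_closed_sums[OF compT closedG, of z z] that Z(2) by auto
    qed
    ultimately show ?thesis using Z(1) by (simp add: closed_UN)
  qed
  \<comment> \<open>The coordinate along \<open>d\<close> is a well-defined unbounded function on the leaf.\<close>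
  obtain d where d: "norm d = 1" "\<And>v. v \<in> periods x0 p0 \<Longrightarrow> v \<bullet> d = 0"
  proof (cases "periods x0 p0 \<subseteq> {0}")
    case True
    show thesis
      by (rule that[of "(1, 0)"]) (use True in \<open>auto simp: norm_Pair\<close>)
  next
    case False
    then obtain v where v: "v \<in> periods x0 p0" "v \<noteq> 0" by blast
    define n where "n = (- snd v, fst v)"
    have "norm n = norm v" by (simp add: n_def norm_prod_def add.commute)
    then have "norm n > 0" using v by simp
    show thesis
    proof (rule that[of "n /\<^sub>R norm n"])
      show "norm (n /\<^sub>R norm n) = 1" using \<open>norm n > 0\<close> by simp
      fix u assume "u \<in> periods x0 p0"
      from periods_parallel[OF no_fixed p0 this v(1)] have "u \<bullet> n = 0"
        by (simp add: n_def inner_prod_def)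
      then show "u \<bullet> (n /\<^sub>R norm n) = 0" by simp
    qed
  qed
  define q where "q = (- snd d, fst d)"
  have dq: "d \<bullet> d = 1" "d \<bullet> q = 0" "q \<bullet> q = 1" "norm q = 1"
    using d(1) by (auto simp: q_def inner_prod_def norm_prod_def power2_eq_square)
  \<comment> \<open>Almost no line in direction \<open>d\<close> contains a critical value.\<close>
  define crit where "crit = (\<lambda>z. {t. \<exists>\<zeta>\<in>ball (c z) (R z). frechet_derivative (T z) (at \<zeta>) = (\<lambda>_. 0) \<and> t - T z \<zeta> \<in> G z})"
  have negl: "negligible ((\<lambda>t. t \<bullet> q) ` crit z)" if z: "z \<in> points S" for z
  proof -
    define h where "h = (\<lambda>\<zeta>. T z \<zeta> \<bullet> q)"
    define B where "B = ball (c z) (R z)"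
    have "C_on 2 B h"
      unfolding h_def B_def
      by (rule C_on_bounded_linear[OF bounded_linear_inner_left open_ball]) (use smT[OF z] in \<open>simp add: smooth_on_def\<close>)
    then have neg: "negligible (h ` {\<zeta> \<in> B. (h has_derivative (\<lambda>_. 0)) (at \<zeta>)})"
      by (intro Sard_two_variables) (simp_all add: B_def)
    have "(\<lambda>t. t \<bullet> q) ` crit z \<subseteq> (\<Union>g\<in>G z. (+) (g \<bullet> q) ` h ` {\<zeta> \<in> B. (h has_derivative (\<lambda>_. 0)) (at \<zeta>)})"
    proof
      fix y assume "y \<in> (\<lambda>t. t \<bullet> q) ` crit z"
      then obtain t \<zeta> where t: "y = t \<bullet> q" "\<zeta> \<in> B" "frechet_derivative (T z) (at \<zeta>) = (\<lambda>_. 0)" "t - T z \<zeta> \<in> G z"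
        by (auto simp: crit_def B_def)
      have "(T z has_derivative (\<lambda>_. 0)) (at \<zeta>)"
        using smooth_on_differentiable[OF smT[OF z], of \<zeta>] t(2,3) frechet_derivative_works[of "T z" "at \<zeta>"]
        by (simp add: B_def)
      then have "(h has_derivative (\<lambda>_. 0)) (at \<zeta>)"
        unfolding h_def using has_derivative_inner_left[of "T z" "\<lambda>_. 0" "at \<zeta>" q] by simp
      moreover have "y = (t - T z \<zeta>) \<bullet> q + h \<zeta>" by (simp add: t(1) h_def inner_diff_left)
      ultimately show "y \<in> (\<Union>g\<in>G z. (+) (g \<bullet> q) ` h ` {\<zeta> \<in> B. (h has_derivative (\<lambda>_. 0)) (at \<zeta>)})"
        using t by blast
    qed
    moreover have "negligible (\<Union>g\<in>G z. (+) (g \<bullet> q) ` h ` {\<zeta> \<in> B. (h has_derivative (\<lambda>_. 0)) (at \<zeta>)})"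
      using countableG neg by (intro negligible_countable_Union) (auto intro: negligible_translation)
    ultimately show ?thesis by (rule negligible_subset[rotated])
  qed
  have regular: "\<exists>e>0. ball t e \<subseteq> Im" if t: "t \<in> Im" "t \<notin> (\<Union>z\<in>Z. crit z)" for t
  proof -
    obtain z \<zeta> where z: "z \<in> Z" and \<zeta>: "\<zeta> \<in> cball (c z) (R z / 2)" "t - T z \<zeta> \<in> G z"
      using ImE[OF t(1)] by blast
    have zS: "z \<in> points S" using z Z(2) by blast
    have \<zeta>b: "\<zeta> \<in> ball (c z) (R z)" using half[OF zS] \<zeta>(1) by blast
    then have "surj (frechet_derivative (T z) (at \<zeta>))"
      using rank[OF zS \<zeta>b] t(2) z \<zeta>(2) unfolding crit_def by blast
    then obtain e where e: "e > 0" "ball (T z \<zeta>) e \<subseteq> T z ` ball (c z) (R z)"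
      using surjective_derivative_interior[OF open_ball \<zeta>b smooth_on_differentiable[OF smT[OF zS]]] by metis
    have "t' \<in> Im" if t': "t' \<in> ball t e" for t'
    proof -
      have "T z \<zeta> + (t' - t) \<in> ball (T z \<zeta>) e" using t' by (simp add: dist_norm norm_minus_commute)
      with e(2) have "T z \<zeta> + (t' - t) \<in> T z ` ball (c z) (R z)" by (rule subsetD)
      then obtain \<zeta>' where \<zeta>': "T z \<zeta> + (t' - t) = T z \<zeta>'" "\<zeta>' \<in> ball (c z) (R z)" by (rule imageE)
      have "t' - T z \<zeta>' = t - T z \<zeta>" by (simp flip: \<zeta>'(1))
      then show "t' \<in> Im" using ImI[OF zS \<zeta>'(2)] \<zeta>(2) by metis
    qed
    then show ?thesis using e(1) by blast
  qed
  define \<tau> where "\<tau> = t0 (cmap S i0 z0)"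
  obtain e where e: "e > 0" "ball \<tau> e \<subseteq> Im"
  proof -
    have b0: "cmap S i0 z0 \<in> ball (cmap S i0 z0) r0" using Q0 by (simp add: Q_def)
    have "surj (frechet_derivative t0 (at (cmap S i0 z0)))"
      using Q0 b0 crit0 nonzero unfolding Q_def by blast
    moreover have "smooth_on (ball (cmap S i0 z0) r0) t0" using Q0 by (simp add: Q_def)
    ultimately obtain e where e: "e > 0" "ball \<tau> e \<subseteq> t0 ` ball (cmap S i0 z0) r0"
      using surjective_derivative_interior[OF open_ball b0 smooth_on_differentiable[of "ball (cmap S i0 z0) r0" t0]]
      unfolding \<tau>_def by blast
    have "t0 \<zeta> \<in> Im" if "\<zeta> \<in> ball (cmap S i0 z0) r0" for \<zeta>
      using Q0 cinv_points[OF z0(1)] that unfolding Q_def Im_def by blast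
    then show thesis using that e by blast
  qed
  obtain a where a: "\<bar>a - \<tau> \<bullet> q\<bar> < e" "\<And>z. z \<in> Z \<Longrightarrow> a \<notin> (\<lambda>t. t \<bullet> q) ` crit z"
  proof -
    have "negligible (\<Union>z\<in>Z. (\<lambda>t. t \<bullet> q) ` crit z)"
      using Z negl by (intro negligible_Union) auto
    moreover have "\<not> negligible (box (\<tau> \<bullet> q - e) (\<tau> \<bullet> q + e))"
      using e(1) by (simp add: negligible_interval(2) box_eq_empty del: box_real)
    ultimately have "\<not> box (\<tau> \<bullet> q - e) (\<tau> \<bullet> q + e) \<subseteq> (\<Union>z\<in>Z. (\<lambda>t. t \<bullet> q) ` crit z)"
      using negligible_subset by blast
    then obtain a where "a \<in> box (\<tau> \<bullet> q - e) (\<tau> \<bullet> q + e)" "a \<notin> (\<Union>z\<in>Z. (\<lambda>t. t \<bullet> q) ` crit z)"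
      by blast
    then show thesis by (intro that[of a]) (auto simp: abs_less_iff)
  qed
  define L where "L = (\<lambda>r. \<tau> + (a - \<tau> \<bullet> q) *\<^sub>R q + r *\<^sub>R d)"
  have Lq: "L r \<bullet> q = a" for r
    using dq by (simp add: L_def inner_add_left)
  have "open (L -` Im)"
  proof (subst open_subopen, intro ballI)
    fix r assume "r \<in> L -` Im"
    moreover have "L r \<notin> (\<Union>z\<in>Z. crit z)" using a(2) Lq by (metis UN_E imageI)
    ultimately obtain e' where e': "e' > 0" "ball (L r) e' \<subseteq> Im" using regular by blast
    have "dist (L r) (L s) = dist r s" for s
      using d(1) by (simp add: L_def dist_norm flip: scaleR_diff_left)
    then have "L s \<in> ball (L r) e'" if "s \<in> ball r e'" for s using that by simp
    then have "ball r e' \<subseteq> L -` Im" using e'(2) by blast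
    then show "\<exists>T. open T \<and> r \<in> T \<and> T \<subseteq> L -` Im" using e'(1) by (intro exI[of _ "ball r e'"]) auto
  qed
  moreover have "closed (L -` Im)"
    unfolding L_def by (intro closed_vimage \<open>closed Im\<close> continuous_intros)
  moreover have "0 \<in> L -` Im"
    using e(2) a(1) dq(4) by (auto simp: L_def dist_norm)
  ultimately have line: "L r \<in> Im" for r
    using clopen[of "L -` Im"] by auto
  \<comment> \<open>Infinitely many equidistant points of the line over finitely many compact discs: two are covered
    from one disc with leaf coordinates at distance less than 1.\<close>
  have "\<exists>F. finite F \<and> T z ` cball (c z) (R z / 2) \<subseteq> (\<Union>x\<in>F. ball x (1/2))" if "z \<in> Z" for z
  proof -
    have "compact (T z ` cball (c z) (R z / 2))" using compT Z(2) that by blast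
    from compact_eq_totally_bounded[THEN iffD1, OF this] show ?thesis
      by (meson half_gt_zero zero_less_one)
  qed
  then obtain F where F: "\<And>z. z \<in> Z \<Longrightarrow> finite (F z) \<and> T z ` cball (c z) (R z / 2) \<subseteq> (\<Union>x\<in>F z. ball x (1/2))"
    by metis
  have "\<exists>z x \<zeta>. (z, x) \<in> Sigma Z F \<and> dist x (T z \<zeta>) < 1/2 \<and> L (real n) - T z \<zeta> \<in> G z" for n
  proof -
    obtain z \<zeta> where z: "z \<in> Z" "\<zeta> \<in> cball (c z) (R z / 2)" "L (real n) - T z \<zeta> \<in> G z"
      using ImE[OF line] by blast
    then obtain x where "x \<in> F z" "T z \<zeta> \<in> ball x (1/2)" using F[of z] by blast
    then show ?thesis using z by auto
  qed
  then obtain zf xf \<zeta>f where f: "\<And>n. (zf n, xf n) \<in> Sigma Z F \<and> dist (xf n) (T (zf n) (\<zeta>f n)) < 1/2 \<and>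
      L (real n) - T (zf n) (\<zeta>f n) \<in> G (zf n)"
    by metis
  have "finite (range (\<lambda>n. (zf n, xf n)))"
    using f Z(1) F by (intro finite_subset[OF _ finite_SigmaI[of Z F]]) auto
  then have "\<not> inj (\<lambda>n::nat. (zf n, xf n))"
    using finite_imageD infinite_UNIV_nat by blast
  then obtain n m :: nat where nm: "n \<noteq> m" "zf n = zf m" "xf n = xf m"
    by (auto simp: inj_def)
  define v where "v = T (zf n) (\<zeta>f n) - T (zf m) (\<zeta>f m)"
  have "dist (T (zf n) (\<zeta>f n)) (T (zf m) (\<zeta>f m)) < 1"
  proof (rule dist_triangle_half_r)
    show "dist (xf n) (T (zf n) (\<zeta>f n)) < 1/2" using f[of n] by blast
    show "dist (xf n) (T (zf m) (\<zeta>f m)) < 1/2" unfolding nm(3) using f[of m] by blast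
  qed
  then have v: "norm v < 1" by (simp add: v_def dist_norm)
  have "(L (real n) - T (zf n) (\<zeta>f n)) - (L (real m) - T (zf m) (\<zeta>f m)) \<in> periods x0 p0"
    using f[of n] f[of m] nm(2) by (intro G_diff) auto
  moreover have "(L (real n) - T (zf n) (\<zeta>f n)) - (L (real m) - T (zf m) (\<zeta>f m)) = (real n - real m) *\<^sub>R d - v"
    by (simp add: L_def v_def algebra_simps)
  ultimately have "((real n - real m) *\<^sub>R d - v) \<bullet> d = 0" using d(2) by metis
  then have "real n - real m = v \<bullet> d" using dq(1) by (simp add: inner_diff_left)
  moreover have "\<bar>v \<bullet> d\<bar> < 1"
    using Cauchy_Schwarz_ineq2[of v d] v d(1) by simp
  ultimately have "\<bar>real n - real m\<bar> < 1" by simp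
  then show False using nm(1) by linarith
qed

end

theorem theorem2p11:
  fixes \<phi> :: "torus_point \<Rightarrow> torus_point"
  assumes isometry: "riemannian_isometry torus flat_metric torus flat_metric \<phi>"
    and no_fixed_geodesic: "\<And>\<gamma> k. closed_geodesic torus flat_metric \<gamma> \<Longrightarrow> k \<ge> 1 \<Longrightarrow>
           (\<phi> ^^ k) ` range \<gamma> \<noteq> range \<gamma>"
  shows "\<not> (\<exists>(S :: ('s, 'i, complex) manifold) N u.
           reeb_2_curve (mapping_torus unit_cotangent (cotangent_lift \<phi>))
             (mt_form liouville) mt_dtheta S N u)"
proof
  assume "\<exists>(S :: ('s, 'i, complex) manifold) N u.
           reeb_2_curve (mapping_torus unit_cotangent (cotangent_lift \<phi>))
             (mt_form liouville) mt_dtheta S N u"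
  then obtain S :: "('s, 'i, complex) manifold" and N u where
    reeb: "reeb_2_curve (mapping_torus unit_cotangent (cotangent_lift \<phi>)) (mt_form liouville) mt_dtheta S N u"
    by blast
  obtain A b where "affine_torus_map \<phi> A b"
    using torus_isometry_affine[OF isometry] by blast
  then interpret affine_torus_map \<phi> A b .
  define w where "w = u \<circ> nodal_proj N"
  have S: "riemann_surface S" "compact_space (manifold_topology S)" and w: "smooth_map S M w"
    and not_exact: "\<not> nodal_exact S N (pullback S M w mt_dtheta)"
    using reeb unfolding reeb_2_curve_def closed_nodal_riemann_surface_def w_def by blast+
  have tangent: "range (dmap S M w i j z) = canonical_distribution M (mt_form liouville) mt_dtheta j (w z)"
    if "i \<in> idx S" "z \<in> cdom S i" "w z \<in> cdom M j" "dmap S M w i j z \<noteq> (\<lambda>_. 0)" for i j z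
    using reeb that dim_canonical_distribution_M[OF that(3)]
    unfolding reeb_2_curve_def w_def[symmetric] idx_M by blast
  have dw: "dmap S M w i j z = (\<lambda>_. 0)" if "i \<in> idx S" "z \<in> cdom S i" "w z \<in> cdom M j" for i j z
    using no_fixed_geodesic S w tangent that by (rule reeb_curve_constant)
  have "nodal_exact S N (pullback S M w mt_dtheta)"
    unfolding nodal_exact_def
  proof (intro exI[of _ "\<lambda>_. 0"] conjI ballI allI)
    show "smooth_map S euclid ((\<lambda>_. 0 :: real) \<circ> nodal_proj N)"
      unfolding smooth_map_def
    proof (intro conjI ballI)
      show "((\<lambda>_. 0) \<circ> nodal_proj N) ` points S \<subseteq> points (euclid :: (real, unit, real) manifold)"
        by (auto simp: points_def euclid_def)
      fix i and j :: unit assume i: "i \<in> idx S"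
      have eq: "cdom S i \<inter> ((\<lambda>_. 0 :: real) \<circ> nodal_proj N) -` cdom euclid j = cdom S i \<inter> cdom S i"
        by (auto simp: euclid_def)
      have op: "open (cmap S i ` (cdom S i \<inter> cdom S i))"
        using S(1) i unfolding riemann_surface_def by blast
      show "open (cmap S i ` (cdom S i \<inter> ((\<lambda>_. 0 :: real) \<circ> nodal_proj N) -` cdom euclid j))"
        unfolding eq by (rule op)
      show "smooth_on (cmap S i ` (cdom S i \<inter> ((\<lambda>_. 0 :: real) \<circ> nodal_proj N) -` cdom euclid j))
          (cmap euclid j \<circ> ((\<lambda>_. 0) \<circ> nodal_proj N) \<circ> cinv S i)"
        unfolding eq unfolding smooth_on_def comp_def
        by (intro allI C_on_if_constant_derivative[OF op, of _ "\<lambda>_. 0"] has_derivative_const)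
    qed
    fix i z v assume i: "i \<in> idx S" and z: "z \<in> cdom S i"
    have "z \<in> points S" using i z by (auto simp: points_def)
    then have "w z \<in> points M" using w by (auto simp: smooth_map_def)
    then obtain j where "j \<in> idx M \<and> w z \<in> cdom M j" by (auto simp: points_def)
    then have "w z \<in> cdom M (SOME j. j \<in> idx M \<and> w z \<in> cdom M j)" by (rule someI2) blast
    from dw[OF i z this] have "pullback S M w mt_dtheta i z v = 0"
      by (simp add: pullback_def mt_dtheta_def)
    then show "dmap S euclid ((\<lambda>_. 0) \<circ> nodal_proj N) i () z v = pullback S M w mt_dtheta i z v"
      by (simp add: dmap_def comp_def)
  qed
  then show False using not_exact by blast
qed

end
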